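(* Let $\varphi\in L_1(\mathbb{R}^d)\cap L_2(\mathbb{R}^d)$ satisfy the refinement equation $\hat\varphi(2u)=H(z)\hat\varphi(u)$, $z=e^{-iu}$, $u\in\mathbb{R}^d$, with a Laurent polynomial $H\in\mathcal{L}$, let $\Phi(z)=\sum_{k\in\mathbb{Z}^d}\tilde\varphi(k)z^k\in\mathcal{L}$ be a Laurent polynomial, and assume there are constants $A,B>0$ with $A\le\Phi(z)\le B$ for all $z\in\mathbb{T}^d$. Let $c\in\mathbb{C}$, $c\ne0$. Suppose that there exists a polynomial $V\in\mathcal{L}$, invertible in $\mathcal{L}(\ell_1)$, such that $d_0\ne0$ is invertible in $\mathcal{L}_\downarrow(\ell_1)$, where $D(z)=cH(z)\Phi(z)V(z)=\sum_{j\in E}d_jz^j$ with $d_j\in\mathcal{L}_\downarrow$. For $j\in E\setminus\{0\}$ let $D_j(z)=d_j-d_0z^{-j}$ and $H_j(z)=\overline{V(z)D_j(z)}$. Then (i) $\langle H,H_j\rangle_\Phi=0$ for all $j\in E\setminus\{0\}$; (ii) the polynomials $\{H_j:j\in E\setminus\{0\}\}$ together with $H$ form a basis of $\mathcal{L}(\ell_1)$ over $\mathcal{L}_\downarrow(\ell_1)$.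
   Context: $E=\{0,1\}^d$; $\mathbb{T}^d=\{z\in\mathbb{C}^d:|z_j|=1\}$; $z^k=z_1^{k_1}\cdots z_d^{k_d}$; $e^{-iu}=(e^{-iu_1},\dots,e^{-iu_d})$. $\hat f(u)=\int_{\mathbb{R}^d}f(x)e^{-iu^Tx}dx$; $\tilde\varphi(u)=\int_{\mathbb{R}^d}\varphi(t)\overline{\varphi(t-u)}\,dt$ is the autocorrelation function, and $\Phi(e^{-iu})=\sum_{k\in\mathbb{Z}^d}|\hat\varphi(u+2\pi k)|^2$. $\mathcal{L}$ is the ring of Laurent polynomials in $z_1,\dots,z_d$ over $\mathbb{C}$; $\mathcal{L}(\ell_1)$ is the ring of Laurent series $\sum_{k\in\mathbb{Z}^d}a_kz^k$ with $a\in\ell_1(\mathbb{Z}^d)$, considered as functions on $\mathbb{T}^d$; $\mathcal{L}_\downarrow=\{P(z^2):P\in\mathcal{L}\}$, $\mathcal{L}_\downarrow(\ell_1)=\{F(z^2):F\in\mathcal{L}(\ell_1)\}$ with $z^2=(z_1^2,\dots,z_d^2)$. Conjugation: $\overline{\sum a_kz^k}=\sum\overline{a_k}z^{-k}$. For $F,G\in\mathcal{L}(\ell_1)$, $\langle F,G\rangle_\Phi(z)=\sum_{s\in E}\Phi((-1)^sz)F((-1)^sz)\overline{G((-1)^sz)}\in\mathcal{L}_\downarrow(\ell_1)$, where $(-1)^sz=((-1)^{s_1}z_1,\dots,(-1)^{s_d}z_d)$. *)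

theory Defs
  imports "HOL-Analysis.Analysis" "HOL-Library.Poly_Mapping"
begin

text \<open>The dimension \<open>d\<close> is \<open>CARD('n)\<close>.\<close>

definition torus :: "(complex ^ 'n) set" where
  "torus = {z. \<forall>i. norm (z $ i) = 1}"

definition binary_vecs :: "(int ^ 'n) set" where
  "binary_vecs = {j. \<forall>i. j $ i \<in> {0, 1}}"

definition monom_at :: "complex ^ 'n \<Rightarrow> int ^ 'n \<Rightarrow> complex" where
  "monom_at z k = (\<Prod>i\<in>UNIV. (z $ i) powi (k $ i))"

definition vec_square :: "complex ^ 'n \<Rightarrow> complex ^ 'n" where
  "vec_square z = (\<chi> i. (z $ i)\<^sup>2)"

definition sign_flip :: "int ^ 'n \<Rightarrow> complex ^ 'n \<Rightarrow> complex ^ 'n" where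
  "sign_flip s z = (\<chi> i. (-1) powi (s $ i) * z $ i)"

definition exp_neg :: "real ^ 'n \<Rightarrow> complex ^ 'n" where
  "exp_neg u = (\<chi> i. exp (- (\<i> * complex_of_real (u $ i))))"


subsection \<open>Laurent polynomials\<close>

text \<open>The product of finitely supported functions on the additive group \<open>\<int>\<^sup>d\<close> in
  \<^theory>\<open>HOL-Library.Poly_Mapping\<close> is convolution, so the type below is the ring of
  Laurent polynomials.\<close>

type_synonym 'n laurent = "(int ^ 'n) \<Rightarrow>\<^sub>0 complex"

definition leval :: "'n::finite laurent \<Rightarrow> complex ^ 'n \<Rightarrow> complex" where
  "leval P z = (\<Sum>k\<in>Poly_Mapping.keys P. Poly_Mapping.lookup P k * monom_at z k)"

definition lmonom :: "int ^ 'n \<Rightarrow> 'n::finite laurent" where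
  "lmonom k = Poly_Mapping.single k 1"

definition lconst :: "complex \<Rightarrow> 'n::finite laurent" where
  "lconst c = Poly_Mapping.single 0 c"

definition lconj :: "'n::finite laurent \<Rightarrow> 'n laurent" where
  "lconj P = (\<Sum>k\<in>Poly_Mapping.keys P. Poly_Mapping.single (- k) (cnj (Poly_Mapping.lookup P k)))"

text \<open>\<open>P(z\<^sub>1\<^sup>2, \<dots>, z\<^sub>d\<^sup>2)\<close>.\<close>

definition lsquare_arg :: "'n::finite laurent \<Rightarrow> 'n laurent" where
  "lsquare_arg P = (\<Sum>k\<in>Poly_Mapping.keys P. Poly_Mapping.single (k + k) (Poly_Mapping.lookup P k))"

definition laurent_down :: "'n::finite laurent set" where
  "laurent_down = range lsquare_arg"


subsection \<open>Absolutely summable Laurent series\<close>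

text \<open>Series are regarded as functions on the torus. They are represented by total functions
  whose values off the torus are irrelevant: all identities between them are stated on
  \<^const>\<open>torus\<close> only.\<close>

definition laurent_l1 :: "(complex ^ 'n \<Rightarrow> complex) set" where
  "laurent_l1 = {F. \<exists>a. (\<lambda>k. norm (a k)) summable_on UNIV \<and>
     (\<forall>z\<in>torus. F z = (\<Sum>\<^sub>\<infinity>k\<in>UNIV. a k * monom_at z k))}"

definition laurent_l1_down :: "(complex ^ 'n \<Rightarrow> complex) set" where
  "laurent_l1_down = {G. \<exists>F\<in>laurent_l1. \<forall>z\<in>torus. G z = F (vec_square z)}"

definition invertible_in :: "(complex ^ 'n \<Rightarrow> complex) set \<Rightarrow> (complex ^ 'n \<Rightarrow> complex) \<Rightarrow> bool" where
  "invertible_in R F \<longleftrightarrow> F \<in> R \<and> (\<exists>G\<in>R. \<forall>z\<in>torus. F z * G z = 1)"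

text \<open>The family \<open>b\<close>, indexed by the finite set \<open>I\<close>, is a basis of \<open>M\<close> as a module over the ring
  \<open>R\<close>: its members lie in \<open>M\<close>, it is linearly independent over \<open>R\<close>, and it spans \<open>M\<close>.\<close>

definition is_basis_over ::
  "(complex ^ 'n \<Rightarrow> complex) set \<Rightarrow> (complex ^ 'n \<Rightarrow> complex) set \<Rightarrow>
   'i set \<Rightarrow> ('i \<Rightarrow> complex ^ 'n \<Rightarrow> complex) \<Rightarrow> bool" where
  "is_basis_over R M I b \<longleftrightarrow>
     (\<forall>i\<in>I. b i \<in> M) \<and>
     (\<forall>a. (\<forall>i\<in>I. a i \<in> R) \<and> (\<forall>z\<in>torus. (\<Sum>i\<in>I. a i z * b i z) = 0)
        \<longrightarrow> (\<forall>i\<in>I. \<forall>z\<in>torus. a i z = 0)) \<and>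
     (\<forall>F\<in>M. \<exists>a. (\<forall>i\<in>I. a i \<in> R) \<and> (\<forall>z\<in>torus. F z = (\<Sum>i\<in>I. a i z * b i z)))"

definition bracket ::
  "(complex ^ 'n \<Rightarrow> complex) \<Rightarrow> (complex ^ 'n \<Rightarrow> complex) \<Rightarrow> (complex ^ 'n \<Rightarrow> complex) \<Rightarrow>
   complex ^ 'n \<Rightarrow> complex" where
  "bracket \<Phi> F G z =
     (\<Sum>s\<in>binary_vecs. \<Phi> (sign_flip s z) * F (sign_flip s z) * cnj (G (sign_flip s z)))"


subsection \<open>Fourier transform and autocorrelation\<close>

definition fourier :: "(real ^ 'n \<Rightarrow> complex) \<Rightarrow> real ^ 'n \<Rightarrow> complex" where
  "fourier f u = (LINT x|lebesgue. f x * exp (- (\<i> * complex_of_real (u \<bullet> x))))"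

definition autocorr :: "(real ^ 'n \<Rightarrow> complex) \<Rightarrow> real ^ 'n \<Rightarrow> complex" where
  "autocorr \<phi> u = (LINT t|lebesgue. \<phi> t * cnj (\<phi> (t - u)))"

end

theory Submission
  imports Defs "HOL-Probability.Levy"
begin

text \<open>Conjugated and divided by \<open>V\<close>, the \<open>H\<^sub>j\<close> become \<open>D\<^sub>j = d\<^sub>j - d\<^sub>0 z\<^sup>-\<^sup>j\<close>, and \<open>\<Phi> H V = D / c\<close>. Since
  averaging \<open>D(z) z\<^sup>-\<^sup>j\<close> over the sign flips of \<open>z\<close> gives \<open>d\<^sub>j\<close>, the bracket of \<open>H\<close> and \<open>H\<^sub>j\<close> is a
  multiple of \<open>d\<^sub>j d\<^sub>0 - d\<^sub>0 d\<^sub>j = 0\<close>. In \<open>F = a\<^sub>0 H + \<Sum>\<^sub>j a\<^sub>j H\<^sub>j\<close> orthogonality forces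
  \<open>a\<^sub>0 = \<langle>F, H\<rangle> / \<langle>H, H\<rangle>\<close>, and the other coefficients are read off from the polyphase components of
  \<open>cnj (F - a\<^sub>0 H) / V\<close>, divided by \<open>- d\<^sub>0\<close>. The denominator is \<open>\<langle>H, H\<rangle>(z) = \<Phi>(z\<^sup>2)\<close>: by uniqueness of
  Fourier transforms the refinement equation holds almost everywhere in the time domain, and it
  then expresses the autocorrelation at \<open>k\<close> through those at integer points. Finally
  \<open>1 / \<Phi>\<close> has absolutely summable coefficients by a Neumann series.\<close>

subsection \<open>Uniqueness of Fourier transforms\<close>

text \<open>The bracket of \<open>H\<close> with itself is usually read off from the periodisation
  of the squared modulus of the Fourier transform, which calls for Poisson summation. Here the
  coefficients of \<open>\<Phi>\<close> are given as autocorrelation values, so comparing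
  coefficients of \<open>z^(2k)\<close> suffices, and the only analytic input is injectivity of the
  Fourier transform on integrable functions. In dimension \<open>d\<close> this is reduced to Levy's
  one-dimensional theorem.

  Elements of the subring are functions of \<open>z^2\<close>, hence constant under sign flips. A
  relation at \<open>z\<close> therefore holds at all \<open>2^d\<close> flipped points with the
  same coefficients, and linear algebra over the subring becomes a matter of character sums over
  \<open>(Z/2)^d\<close>.

  For spanning, \<open>2^d\<close> polyphase components \<open>g_j\<close> have to be matched by
  only \<open>2^d - 1\<close> coefficients besides that of \<open>H\<close>. The surplus equation is
  \<open>sum_j g_j d_j = 0\<close>, and it says exactly that the remainder has zero bracket with
  \<open>H\<close>. This is why the multiple of \<open>H\<close> is split off before the other
  coefficients are chosen.\<close>

text \<open>The signed measure with density \<open>f\<close>, pushed forward along \<open>X\<close>,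
  has vanishing characteristic function. Levy's theorem concerns probability laws, so the positive
  and negative parts are normalised and compared.\<close>

lemma integral_indicator_vimage_eq_0_real:
  fixes f :: "'a \<Rightarrow> real" and X :: "'a \<Rightarrow> real"
  assumes f: "integrable M f" and X[measurable]: "X \<in> borel_measurable M"
    and zero: "\<And>u. (LINT x|M. complex_of_real (f x) * iexp (u * X x)) = 0"
    and B[measurable]: "B \<in> sets borel"
  shows "(LINT x|M. f x * indicator B (X x)) = 0"
proof -
  have [measurable]: "f \<in> borel_measurable M" using f by auto
  define p n where "p x = max 0 (f x)" and "n x = max 0 (- f x)" for x
  have p[measurable]: "integrable M p" and n[measurable]: "integrable M n"
    unfolding p_def n_def using f by auto
  have pm[measurable]: "p \<in> borel_measurable M" "n \<in> borel_measurable M"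
    using p n by auto
  have pn: "p x \<ge> 0" "n x \<ge> 0" "f x = p x - n x" for x
    by (auto simp: p_def n_def)
  have int_exp: "integrable M (\<lambda>x. complex_of_real (q x) * iexp (u * X x))"
    if "integrable M q" for q :: "'a \<Rightarrow> real" and u
    by (rule Bochner_Integration.integrable_bound[OF that]) (use that in \<open>auto simp: norm_mult\<close>)
  have int_ind: "integrable M (\<lambda>x. q x * indicator B (X x))"
    if "integrable M q" for q :: "'a \<Rightarrow> real"
    by (rule Bochner_Integration.integrable_bound[OF that])
      (use that in \<open>auto simp: indicator_def\<close>)
  have eq_exp: "(LINT x|M. complex_of_real (p x) * iexp (u * X x)) =
      (LINT x|M. complex_of_real (n x) * iexp (u * X x))" for u
    using zero[of u] int_exp[OF p, of u] int_exp[OF n, of u]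
    by (simp add: pn(3) algebra_simps)
  \<comment> \<open>At \<open>u = 0\<close> the hypothesis says that both parts have the same mass,
    so one constant normalises both.\<close>
  define m where "m = integral\<^sup>L M p"
  have m: "integral\<^sup>L M n = m"
    using eq_exp[of 0] by (simp add: m_def)
  have goal: "(LINT x|M. f x * indicator B (X x)) =
      (LINT x|M. p x * indicator B (X x)) - (LINT x|M. n x * indicator B (X x))"
    using int_ind[OF p] int_ind[OF n] by (simp add: pn(3) algebra_simps)
  \<comment> \<open>Zero mass cannot be normalised, but it forces \<open>f\<close> to vanish almost
    everywhere.\<close>
  show ?thesis
  proof (cases "m = 0")
    case True
    then have "AE x in M. p x = 0" "AE x in M. n x = 0"
      using integral_nonneg_eq_0_iff_AE[OF p] integral_nonneg_eq_0_iff_AE[OF n] pn m m_def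
      by auto
    then have "AE x in M. f x * indicator B (X x) = 0"
      by eventually_elim (auto simp: pn(3))
    then show ?thesis
      by (subst integral_cong_AE[where g="\<lambda>_. 0"]) auto
  next
    case False
    have "m \<ge> 0" unfolding m_def using pn by auto
    with False have m0: "m > 0" by auto
    define P where "P q = distr (density M (\<lambda>x. ennreal (q x / m))) borel X" for q :: "'a \<Rightarrow> real"
    have dist: "real_distribution (P q)" if q: "integrable M q" "integral\<^sup>L M q = m" "\<And>x. q x \<ge> 0" for q
    proof -
      have qm[measurable]: "q \<in> borel_measurable M" using q by auto
      have "emeasure (density M (\<lambda>x. ennreal (q x / m))) (space (density M (\<lambda>x. ennreal (q x / m)))) = 1"
        using q m0
        by (simp add: emeasure_density nn_integral_eq_integral)
      then have "prob_space (density M (\<lambda>x. ennreal (q x / m)))"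
        by (rule prob_spaceI)
      then interpret D: prob_space "density M (\<lambda>x. ennreal (q x / m))" .
      have "prob_space (P q)"
        unfolding P_def by (rule D.prob_space_distr) auto
      then show ?thesis
        by (simp add: real_distribution_def real_distribution_axioms_def P_def)
    qed
    have ch: "char (P q) u = (LINT x|M. complex_of_real (q x) * iexp (u * X x)) / m"
      if q: "integrable M q" "\<And>x. q x \<ge> 0" for q u
    proof -
      have qm[measurable]: "q \<in> borel_measurable M" using q by auto
      have "char (P q) u = (LINT x|M. (q x / m) *\<^sub>R iexp (u * X x))"
        unfolding char_def P_def using q m0
        by (subst integral_distr) (auto simp: integral_density)
      also have "\<dots> = (LINT x|M. (complex_of_real (q x) * iexp (u * X x)) / m)"
        by (intro Bochner_Integration.integral_cong) (auto simp: scaleR_conv_of_real)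
      finally show ?thesis by simp
    qed
    have "P p = P n"
    proof (rule Levy_uniqueness)
      show "real_distribution (P p)" by (rule dist[OF p m_def[symmetric] pn(1)])
      show "real_distribution (P n)" by (rule dist[OF n m pn(2)])
      show "char (P p) = char (P n)"
        by (rule ext) (simp only: ch[OF p pn(1)] ch[OF n pn(2)] eq_exp)
    qed
    have mP: "measure (P q) B = (LINT x|M. q x * indicator B (X x)) / m"
      if q: "integrable M q" "\<And>x. q x \<ge> 0" for q
    proof -
      have qm[measurable]: "q \<in> borel_measurable M" using q by auto
      have "emeasure (P q) B = (\<integral>\<^sup>+x. ennreal ((q x / m) * indicator B (X x)) \<partial>M)"
        unfolding P_def using q m0
        by (subst emeasure_distr)
          (auto simp: emeasure_density indicator_def intro!: nn_integral_cong)
      also have "\<dots> = ennreal (LINT x|M. (q x / m) * indicator B (X x))"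
        using q m0 int_ind[OF q(1)]
        by (intro nn_integral_eq_integral) (auto simp: divide_simps)
      finally have "measure (P q) B = (LINT x|M. (q x / m) * indicator B (X x))"
        by (simp add: measure_def integral_nonneg_AE q less_imp_le[OF m0])
      then show ?thesis by simp
    qed
    have "(LINT x|M. p x * indicator B (X x)) / m = (LINT x|M. n x * indicator B (X x)) / m"
      unfolding mP[OF p pn(1), symmetric] mP[OF n pn(2), symmetric] \<open>P p = P n\<close> ..
    then show ?thesis using goal m0 by simp
  qed
qed

text \<open>The exponential is complex, so the hypothesis does not split directly into real and
  imaginary parts. Conjugating it at \<open>- u\<close> shows that \<open>cnj f\<close> satisfies it
  as well, and \<open>Re f\<close> and \<open>Im f\<close> are combinations of \<open>f\<close> and
  \<open>cnj f\<close>.\<close>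

lemma integral_indicator_vimage_eq_0:
  fixes f :: "'a \<Rightarrow> complex" and X :: "'a \<Rightarrow> real"
  assumes f: "integrable M f" and X[measurable]: "X \<in> borel_measurable M"
    and zero: "\<And>u. (LINT x|M. f x * iexp (u * X x)) = 0"
    and B[measurable]: "B \<in> sets borel"
  shows "(LINT x|M. f x * indicator B (X x)) = 0"
proof -
  have [measurable]: "f \<in> borel_measurable M" using f by auto
  have fi: "integrable M (\<lambda>x. f x * iexp (u * X x))" for u
    by (rule Bochner_Integration.integrable_bound[OF f]) (use f in \<open>auto simp: norm_mult\<close>)
  have fc[measurable]: "(\<lambda>x. cnj (f x)) \<in> borel_measurable M" using f by (auto simp: borel_measurable_integrable)
  have fi2: "integrable M (\<lambda>x. cnj (f x) * iexp (u * X x))" for u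
    by (rule Bochner_Integration.integrable_bound[OF f]) (use f in \<open>auto simp: norm_mult\<close>)
  have conj: "(LINT x|M. cnj (f x) * iexp (u * X x)) = 0" for u
  proof -
    have "(LINT x|M. cnj (f x) * iexp (u * X x)) = cnj (LINT x|M. f x * iexp (- u * X x))"
      unfolding Bochner_Integration.integral_cnj[symmetric]
      by (intro Bochner_Integration.integral_cong) (auto simp: exp_cnj)
    then show ?thesis using zero[of "-u"] by simp
  qed
  have R: "(LINT x|M. Re (f x) * indicator B (X x)) = 0"
  proof (rule integral_indicator_vimage_eq_0_real)
    fix u
    have "(LINT x|M. complex_of_real (Re (f x)) * iexp (u * X x)) =
      (LINT x|M. (f x * iexp (u * X x) + cnj (f x) * iexp (u * X x)) / 2)"
      by (intro Bochner_Integration.integral_cong)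
        (simp_all add: complex_add_cnj flip: distrib_right)
    also have "\<dots> = 0" using zero[of u] conj[of u] fi[of u] fi2[of u] by simp
    finally show "(LINT x|M. complex_of_real (Re (f x)) * iexp (u * X x)) = 0" .
  qed (use f in auto)
  have Im: "complex_of_real (Im w) = (w - cnj w) / (2 * \<i>)" for w
    by (simp add: complex_eq_iff)
  have I: "(LINT x|M. Im (f x) * indicator B (X x)) = 0"
  proof (rule integral_indicator_vimage_eq_0_real)
    fix u
    have "(LINT x|M. complex_of_real (Im (f x)) * iexp (u * X x)) =
      (LINT x|M. (f x * iexp (u * X x) - cnj (f x) * iexp (u * X x)) / (2 * \<i>))"
      by (intro Bochner_Integration.integral_cong)
        (simp_all add: Im diff_divide_distrib left_diff_distrib)
    also have "\<dots> = 0" using zero[of u] conj[of u] fi[of u] fi2[of u] by simp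
    finally show "(LINT x|M. complex_of_real (Im (f x)) * iexp (u * X x)) = 0" .
  qed (use f in auto)
  have ib: "integrable M (\<lambda>x. f x * indicator B (X x))"
    by (rule Bochner_Integration.integrable_bound[OF f]) (use f in \<open>auto simp: norm_mult indicator_def\<close>)
  show ?thesis
  proof (rule complex_eqI)
    show "Re (LINT x|M. f x * indicator B (X x)) = Re 0"
      unfolding integral_Re[OF ib, symmetric] zero_complex.sel R[symmetric]
      by (intro Bochner_Integration.integral_cong) (auto simp: indicator_def)
    show "Im (LINT x|M. f x * indicator B (X x)) = Im 0"
      unfolding integral_Im[OF ib, symmetric] zero_complex.sel I[symmetric]
      by (intro Bochner_Integration.integral_cong) (auto simp: indicator_def)
  qed
qed

text \<open>Exponentials are traded for indicators one coordinate at a time, each trade being an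
  instance of the one-dimensional result with \<open>X\<close> a coordinate function.\<close>

lemma integral_box_eq_0:
  fixes f :: "real ^ 'n \<Rightarrow> complex"
  assumes f: "integrable lebesgue f" and zero: "\<And>u. fourier f u = 0"
    and B: "\<And>i. B i \<in> sets borel"
  shows "(LINT x|lebesgue. f x * (\<Prod>i\<in>UNIV. indicator (B i) (x $ i))) = 0"
proof -
  have fm[measurable]: "f \<in> borel_measurable lebesgue" using f by auto
  have [measurable]: "B i \<in> sets borel" for i by (rule B)
  have coord[measurable]: "(\<lambda>x::real^'n. x $ i) \<in> borel_measurable lebesgue" for i
    by (rule measurable_completion) (auto intro!: borel_measurable_continuous_onI continuous_intros)
  \<comment> \<open>Interpolates between a pure exponential (\<open>S\<close> empty) and the
    indicator of a product set (\<open>S = UNIV\<close>): the coordinates in \<open>S\<close> are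
    already traded.\<close>
  define K :: "'n set \<Rightarrow> ('n \<Rightarrow> real) \<Rightarrow> real^'n \<Rightarrow> complex"
    where "K S u x = (\<Prod>i\<in>S. indicator (B i) (x $ i)) * (\<Prod>i\<in>-S. iexp (u i * x $ i))" for S u x
  have K[measurable]: "K S u \<in> borel_measurable lebesgue" for S u
    unfolding K_def by measurable
  have "(LINT x|lebesgue. f x * K S u x) = 0" if "finite S" for S u
    using that
  proof (induction S arbitrary: u rule: finite_induct)
    case empty
    have "(LINT x|lebesgue. f x * K {} u x) = fourier f (\<chi> i. - u i)"
      unfolding fourier_def K_def
      by (intro Bochner_Integration.integral_cong)
        (auto simp: exp_sum[symmetric] inner_vec_def sum_negf sum_distrib_left)
    then show ?case using zero by simp
  next
    case (insert j S)
    \<comment> \<open>Everything except the factor of coordinate \<open>j\<close> is absorbed into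
      the integrable function. The frequency \<open>t\<close> in that coordinate is free because the
      induction hypothesis covers all \<open>u\<close>.\<close>
    define g where "g x = f x * ((\<Prod>i\<in>S. indicator (B i) (x $ i)) * (\<Prod>i\<in>-insert j S. iexp (u i * x $ i)))" for x
    have [measurable]: "g \<in> borel_measurable lebesgue"
      unfolding g_def by measurable
    have g: "integrable lebesgue g"
      by (rule Bochner_Integration.integrable_bound[OF f])
        (auto simp: g_def norm_mult prod_norm[symmetric] indicator_def if_distrib[of norm] mult_left_le
          intro!: prod_le_1 mult_left_le mult_le_one cong: if_cong)
    have "(LINT x|lebesgue. g x * iexp (t * x $ j)) = 0" for t
    proof -
      have eq: "-S = insert j (-insert j S)" using insert by auto
      have "g x * iexp (t * x $ j) = f x * K S (u(j := t)) x" for x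
        unfolding K_def g_def eq
        by (subst prod.insert) (auto simp: algebra_simps intro!: prod.cong)
      then show ?thesis using insert.IH by simp
    qed
    then have "(LINT x|lebesgue. g x * indicator (B j) (x $ j)) = 0"
      using integral_indicator_vimage_eq_0[OF g coord, of j "B j"] by auto
    moreover have "f x * K (insert j S) u x = g x * indicator (B j) (x $ j)" for x
      using insert by (simp add: K_def g_def algebra_simps)
    ultimately show ?case by simp
  qed
  from this[of UNIV] show ?thesis by (simp add: K_def)
qed

text \<open>The positive and negative parts of \<open>g\<close> are densities of finite measures
  that agree on boxes. Boxes are stable under intersection and generate the Borel sets, so the
  measures agree, and densities are unique almost everywhere.\<close>

lemma AE_eq_0_if_integral_box_eq_0:
  fixes g :: "real ^ 'n \<Rightarrow> real"
  assumes g: "integrable lborel g" and zero: "\<And>a b. (LINT x|lborel. g x * indicator (box a b) x) = 0"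
  shows "AE x in lborel. g x = 0"
proof -
  define p n where "p x = max 0 (g x)" and "n x = max 0 (- g x)" for x
  have p: "integrable lborel p" and n: "integrable lborel n"
    unfolding p_def n_def using g by auto
  have pm[measurable]: "p \<in> borel_measurable borel" "n \<in> borel_measurable borel"
    using p n by auto
  have pn: "p x \<ge> 0" "n x \<ge> 0" "g x = p x - n x" for x
    by (auto simp: p_def n_def)
  have em: "emeasure (density lborel (\<lambda>x. ennreal (q x))) (box a b) = ennreal (LINT x|lborel. q x * indicator (box a b) x)"
    and ib: "integrable lborel (\<lambda>x. q x * indicator (box a b) x)"
    if q: "integrable lborel q" "\<And>x. q x \<ge> 0" for q a b
  proof -
    have [measurable]: "q \<in> borel_measurable borel" using q by auto
    show ib: "integrable lborel (\<lambda>x. q x * indicator (box a b) x)"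
      by (rule Bochner_Integration.integrable_bound[OF q(1)]) (auto simp: indicator_def)
    have "emeasure (density lborel (\<lambda>x. ennreal (q x))) (box a b) =
      (\<integral>\<^sup>+x. ennreal (q x * indicator (box a b) x) \<partial>lborel)"
      by (auto simp: emeasure_density indicator_def intro!: nn_integral_cong)
    also have "\<dots> = ennreal (LINT x|lborel. q x * indicator (box a b) x)"
      using ib q by (intro nn_integral_eq_integral) auto
    finally show "emeasure (density lborel (\<lambda>x. ennreal (q x))) (box a b) = ennreal (LINT x|lborel. q x * indicator (box a b) x)" .
  qed
  have "density lborel (\<lambda>x. ennreal (p x)) = density lborel (\<lambda>x. ennreal (n x))"
  proof (rule measure_eqI_generator_eq[where E="range (\<lambda>(a,b). box a b)" and \<Omega>=UNIV
        and A="\<lambda>k::nat. box (- real k *\<^sub>R One) (real k *\<^sub>R One)"])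
    show "Int_stable (range (\<lambda>(a,b). box a b :: (real^'n) set))"
      by (auto simp: Int_stable_def box_Int_box)
    show "range (\<lambda>k. box (- real k *\<^sub>R One) (real k *\<^sub>R One)) \<subseteq> range (\<lambda>(a, b). box a b :: (real^'n) set)"
      by auto
    show "(\<Union>k. box (- real k *\<^sub>R One) (real k *\<^sub>R One :: real^'n)) = UNIV"
      using UN_box_eq_UNIV[where 'a="real^'n"] by simp
    fix X :: "(real^'n) set" assume "X \<in> range (\<lambda>(a,b). box a b)"
    then obtain a b where X: "X = box a b" by auto
    have "(LINT x|lborel. p x * indicator (box a b) x) = (LINT x|lborel. n x * indicator (box a b) x)"
      using zero[of a b] ib[OF p pn(1), of a b] ib[OF n pn(2), of a b]
      by (simp add: pn(3) algebra_simps)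
    then show "emeasure (density lborel (\<lambda>x. ennreal (p x))) X = emeasure (density lborel (\<lambda>x. ennreal (n x))) X"
      unfolding X em[OF p pn(1)] em[OF n pn(2)] by simp
  next
    fix k show "emeasure (density lborel (\<lambda>x. ennreal (p x))) (box (- real k *\<^sub>R One) (real k *\<^sub>R One)) \<noteq> \<infinity>"
      unfolding em[OF p pn(1)] by simp
  qed (auto simp: borel_eq_box sets_measure_of)
  then have "AE x in lborel. ennreal (p x) = ennreal (n x)"
    by (intro sigma_finite_measure.density_unique[OF sigma_finite_lborel]) auto
  then show ?thesis
    by eventually_elim (use pn in auto)
qed

text \<open>A box is a product of open intervals, so its indicator is one of the products for which
  the integral is known to vanish. Real and imaginary parts are then treated separately.\<close>

lemma fourier_eq_0_imp_AE_0:
  fixes f :: "real ^ 'n \<Rightarrow> complex"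
  assumes f: "integrable lebesgue f" and zero: "\<And>u. fourier f u = 0"
  shows "AE x in lebesgue. f x = 0"
proof -
  have box: "(LINT x|lebesgue. f x * indicator (box a b) x) = 0" for a b
  proof -
    have "(\<Prod>i\<in>UNIV. indicator {a $ i <..< b $ i} (x $ i)) = (indicator (box a b) x :: complex)" for x
      by (auto simp: indicator_def mem_box_cart)
    then show ?thesis
      using integral_box_eq_0[OF f zero, of "\<lambda>i. {a $ i <..< b $ i}"] by simp
  qed
  have ib: "integrable lebesgue (\<lambda>x. f x * indicator (box a b) x)" for a b
  proof (rule Bochner_Integration.integrable_bound[OF f])
    have [measurable]: "f \<in> borel_measurable lebesgue" using f by auto
    have [measurable]: "box a b \<in> sets lebesgue" by auto
    show "(\<lambda>x. f x * indicator (box a b) x) \<in> borel_measurable lebesgue" by measurable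
  qed (auto simp: norm_mult indicator_def)
  have *: "AE x in lebesgue. r (f x) = 0" if r: "r = Re \<or> r = Im" for r
  proof -
    have ri: "integrable lebesgue (\<lambda>x. r (f x))" using f r by auto
    \<comment> \<open>\<open>f\<close> is only Lebesgue measurable, whereas the argument with boxes
      determines measures on Borel sets; a Borel representative bridges the gap.\<close>
    then obtain g where g[measurable]: "g \<in> borel_measurable lborel" and eq: "AE x in lborel. r (f x) = g x"
      using completion_ex_borel_measurable_real[of "\<lambda>x. r (f x)" lborel] by auto
    have eq': "AE x in lebesgue. r (f x) = g x" using eq by (rule AE_completion)
    have gm[measurable]: "g \<in> borel_measurable lebesgue" by (rule measurable_completion) (rule g)
    have "integrable lebesgue g"
      using ri eq' by (subst integrable_cong_AE[where g="\<lambda>x. r (f x)"]) auto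
    then have gi: "integrable lborel g"
      using g integrable_completion by blast
    have "AE x in lborel. g x = 0"
    proof (rule AE_eq_0_if_integral_box_eq_0[OF gi])
      fix a b :: "real^'n"
      have "(LINT x|lborel. g x * indicator (box a b) x) = (LINT x|lebesgue. g x * indicator (box a b) x)"
        by (subst integral_completion) auto
      also have "\<dots> = (LINT x|lebesgue. r (f x * indicator (box a b) x))"
      proof (rule integral_cong_AE)
        have [measurable]: "f \<in> borel_measurable lebesgue" "box a b \<in> sets lebesgue" using f by auto
        show "(\<lambda>x. g x * indicator (box a b) x) \<in> borel_measurable lebesgue" by measurable
        show "(\<lambda>x. r (f x * indicator (box a b) x)) \<in> borel_measurable lebesgue"
          by (rule measurable_compose[of _ _ borel r]) (use r in \<open>auto intro: borel_measurable_Re borel_measurable_Im\<close>)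
        show "AE x in lebesgue. g x * indicator (box a b) x = r (f x * indicator (box a b) x)"
          using eq' by eventually_elim (use r in \<open>auto simp: indicator_def split: if_splits\<close>)
      qed
      also have "\<dots> = r (LINT x|lebesgue. f x * indicator (box a b) x)"
        by (rule disjE[OF r]) (simp_all only: integral_Re[OF ib] integral_Im[OF ib])
      finally show "(LINT x|lborel. g x * indicator (box a b) x) = 0" using r by (auto simp only: box zero_complex.sel)
    qed
    then have "AE x in lebesgue. g x = 0" by (rule AE_completion)
    with eq' show ?thesis by eventually_elim auto
  qed
  have "AE x in lebesgue. Re (f x) = 0" "AE x in lebesgue. Im (f x) = 0" using * by auto
  then show ?thesis by eventually_elim (auto intro: complex_eqI)
qed

subsection \<open>The refinement equation in the time domain\<close>

text \<open>All three parts rest on one fact: up to the factor \<open>\<bar>c\<bar>^d\<close>,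
  Lebesgue measure is its own image under the affine map. It is used for translations
  (\<open>c = 1\<close>) and for the dilation \<open>c = 1/2\<close>.\<close>

lemma
  fixes t :: "real ^ 'n" and c :: real and f g :: "real ^ 'n \<Rightarrow> 'b::{banach, second_countable_topology}"
  assumes c: "c \<noteq> 0" and f: "f \<in> borel_measurable lebesgue" and g: "g \<in> borel_measurable lebesgue"
  shows lebesgue_integral_affine:
      "(LINT x|lebesgue. f (t + c *\<^sub>R x)) = (LINT x|lebesgue. f x) /\<^sub>R \<bar>c\<bar> ^ CARD('n)"
    and integrable_lebesgue_affine:
      "integrable lebesgue f \<Longrightarrow> integrable lebesgue (\<lambda>x. f (t + c *\<^sub>R x))"
    and AE_lebesgue_affine:
      "AE x in lebesgue. f x = g x \<Longrightarrow> AE x in lebesgue. f (t + c *\<^sub>R x) = g (t + c *\<^sub>R x)"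
proof -
  define T where "T = (\<lambda>x::real^'n. t + c *\<^sub>R x)"
  have T_eq: "T = (\<lambda>x. t + (\<Sum>j\<in>Basis. (c * (x \<bullet> j)) *\<^sub>R j))"
    by (auto simp: T_def fun_eq_iff euclidean_representation simp flip: scaleR_scaleR scaleR_sum_right)
  have leb: "lebesgue = density (distr lebesgue lebesgue T) (\<lambda>_. ennreal (\<bar>c\<bar> ^ CARD('n)))"
    unfolding T_eq using lebesgue_affine_euclidean[of "\<lambda>_::real^'n. c" t] c by (simp add: ennreal_power)
  have T[measurable]: "T \<in> lebesgue \<rightarrow>\<^sub>M lebesgue"
    unfolding T_eq by (rule lebesgue_affine_measurable) (use c in auto)
  note [measurable] = f g
  have "(LINT x|lebesgue. f x) = \<bar>c\<bar> ^ CARD('n) *\<^sub>R (LINT x|lebesgue. f (T x))"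
    by (subst leb) (simp add: integral_density integral_distr)
  then show "(LINT x|lebesgue. f (t + c *\<^sub>R x)) = (LINT x|lebesgue. f x) /\<^sub>R \<bar>c\<bar> ^ CARD('n)"
    using c by (simp add: T_def)
  show "integrable lebesgue (\<lambda>x. f (t + c *\<^sub>R x))" if "integrable lebesgue f"
  proof -
    have "integrable (distr lebesgue lebesgue T) (\<lambda>x. (\<bar>c\<bar> ^ CARD('n)) *\<^sub>R f x)"
      using that by (subst (asm) leb) (simp add: integrable_density)
    then have "integrable lebesgue (\<lambda>x. (\<bar>c\<bar> ^ CARD('n)) *\<^sub>R f (T x))"
      by (subst (asm) integrable_distr_eq) auto
    from integrable_scaleR_right[OF this, of "1 / \<bar>c\<bar> ^ CARD('n)"] show ?thesis
      using c by (simp add: T_def)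
  qed
  show "AE x in lebesgue. f (t + c *\<^sub>R x) = g (t + c *\<^sub>R x)" if "AE x in lebesgue. f x = g x"
  proof -
    have "AE x in distr lebesgue lebesgue T. f x = g x"
      using that c by (subst (asm) leb) (simp add: AE_density)
    \<comment> \<open>\<open>AE_distr_iff\<close> requires the set where \<open>f\<close> and
      \<open>g\<close> agree to be measurable; it is the preimage of \<open>{0}\<close> under
      \<open>f - g\<close>.\<close>
    then have "AE x in lebesgue. f (T x) = g (T x)"
      using measurable_sets[OF borel_measurable_diff[OF f g], of "{0}"]
      by (subst (asm) AE_distr_iff) (auto simp: vimage_def)
    then show ?thesis by (simp add: T_def)
  qed
qed

section \<open>Fourier transforms of integer translates and dilates\<close>

definition real_vec :: "int ^ 'n \<Rightarrow> real ^ 'n" where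
  "real_vec k = (\<chi> i. real_of_int (k $ i))"

lemma real_vec_add: "real_vec (k + l) = real_vec k + real_vec l"
  and real_vec_diff: "real_vec (k - l) = real_vec k - real_vec l"
  by (auto simp: real_vec_def vec_eq_iff)

text \<open>Identifies \<open>z^k\<close> at \<open>z = e^(-iu)\<close> with the multiplier of
  translation by \<open>k\<close>, so that multiplying a transform by \<open>H(z)\<close> amounts to
  a finite combination of integer translates.\<close>

lemma monom_at_exp_neg:
  "monom_at (exp_neg u) k = exp (- (\<i> * complex_of_real (u \<bullet> real_vec k)))"
  by (auto simp: monom_at_def exp_neg_def exp_power_int inner_vec_def real_vec_def exp_sum[symmetric]
      sum_distrib_left sum_negf[symmetric] algebra_simps intro!: arg_cong[where f=exp] sum.cong)

lemma measurable_exp_inner [measurable]: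
  "(\<lambda>x::real^'n. exp (- (\<i> * complex_of_real (u \<bullet> x)))) \<in> borel_measurable lebesgue"
  by (rule measurable_completion) (auto intro!: borel_measurable_continuous_onI continuous_intros)

lemma integrable_fourier_integrand:
  fixes f :: "real ^ 'n \<Rightarrow> complex"
  assumes "integrable lebesgue f"
  shows "integrable lebesgue (\<lambda>x. f x * exp (- (\<i> * complex_of_real (u \<bullet> x))))"
proof (rule Bochner_Integration.integrable_bound[OF assms])
  have [measurable]: "f \<in> borel_measurable lebesgue" using assms by auto
  show "(\<lambda>x. f x * exp (- (\<i> * complex_of_real (u \<bullet> x)))) \<in> borel_measurable lebesgue" by measurable
qed (auto simp: norm_mult)

lemma fourier_translate:
  fixes f :: "real ^ 'n \<Rightarrow> complex"
  assumes f: "integrable lebesgue f"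
  shows "fourier (\<lambda>x. f (x - a)) u = exp (- (\<i> * complex_of_real (u \<bullet> a))) * fourier f u"
proof -
  define F where "F y = exp (- (\<i> * complex_of_real (u \<bullet> a))) * (f y * exp (- (\<i> * complex_of_real (u \<bullet> y))))" for y
  have "integrable lebesgue F" unfolding F_def
    by (intro integrable_mult_right integrable_fourier_integrand f)
  then have Fm: "F \<in> borel_measurable lebesgue" by auto
  have F: "F (- a + 1 *\<^sub>R x) = f (x - a) * exp (- (\<i> * complex_of_real (u \<bullet> x)))" for x
    unfolding F_def by (simp add: exp_add[symmetric] inner_diff_right algebra_simps)
  have "fourier (\<lambda>x. f (x - a)) u = (LINT x|lebesgue. F (- a + 1 *\<^sub>R x))"
    unfolding fourier_def F ..
  also have "\<dots> = integral\<^sup>L lebesgue F"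
    by (subst lebesgue_integral_affine[OF _ Fm Fm]) auto
  also have "\<dots> = exp (- (\<i> * complex_of_real (u \<bullet> a))) * fourier f u"
    unfolding F_def fourier_def by simp
  finally show ?thesis .
qed

lemma fourier_dilate:
  fixes f :: "real ^ 'n \<Rightarrow> complex"
  assumes f: "integrable lebesgue f"
  shows "fourier (\<lambda>x. f ((1/2) *\<^sub>R x)) u = 2 ^ CARD('n) * fourier f (2 *\<^sub>R u)"
proof -
  define F where "F y = f y * exp (- (\<i> * complex_of_real ((2 *\<^sub>R u) \<bullet> y)))" for y
  have "integrable lebesgue F" unfolding F_def
    by (intro integrable_fourier_integrand f)
  then have Fm: "F \<in> borel_measurable lebesgue" by auto
  have F: "F (0 + (1/2) *\<^sub>R x) = f ((1/2) *\<^sub>R x) * exp (- (\<i> * complex_of_real (u \<bullet> x)))" for x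
    unfolding F_def by simp
  have "fourier (\<lambda>x. f ((1/2) *\<^sub>R x)) u = (LINT x|lebesgue. F (0 + (1/2) *\<^sub>R x))"
    unfolding fourier_def F ..
  also have "\<dots> = integral\<^sup>L lebesgue F /\<^sub>R \<bar>1/2\<bar> ^ CARD('n)"
    by (rule lebesgue_integral_affine[OF _ Fm Fm]) auto
  also have "\<dots> = 2 ^ CARD('n) * fourier f (2 *\<^sub>R u)"
    unfolding F_def fourier_def by (simp add: scaleR_conv_of_real power_one_over)
  finally show ?thesis .
qed

text \<open>The difference of the two sides is integrable, and by the refinement equation its
  Fourier transform vanishes everywhere. The factor \<open>2^d\<close> is the Jacobian of the
  dilation.\<close>

lemma refinement_equation_AE:
  fixes \<phi> :: "real ^ 'n \<Rightarrow> complex" and H :: "'n laurent"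
  assumes L1: "integrable lebesgue \<phi>"
    and refinement: "\<And>u. fourier \<phi> (2 *\<^sub>R u) = leval H (exp_neg u) * fourier \<phi> u"
  shows "AE x in lebesgue. \<phi> ((1/2) *\<^sub>R x) =
    2 ^ CARD('n) * (\<Sum>k\<in>Poly_Mapping.keys H. Poly_Mapping.lookup H k * \<phi> (x - real_vec k))"
proof -
  let ?K = "Poly_Mapping.keys H" and ?h = "Poly_Mapping.lookup H"
  have m: "\<phi> \<in> borel_measurable lebesgue" using L1 by auto
  have i1: "integrable lebesgue (\<lambda>x. \<phi> ((1/2) *\<^sub>R x))"
    using integrable_lebesgue_affine[OF _ m m L1, of "1/2" 0] by simp
  have i2: "integrable lebesgue (\<lambda>x. \<phi> (x - real_vec k))" for k
    using integrable_lebesgue_affine[OF _ m m L1, of 1 "- real_vec k"] by simp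
  have "AE x in lebesgue. \<phi> ((1/2) *\<^sub>R x) - 2 ^ CARD('n) * (\<Sum>k\<in>?K. ?h k * \<phi> (x - real_vec k)) = 0"
  proof (rule fourier_eq_0_imp_AE_0)
    show "integrable lebesgue (\<lambda>x. \<phi> ((1/2) *\<^sub>R x) - 2 ^ CARD('n) * (\<Sum>k\<in>?K. ?h k * \<phi> (x - real_vec k)))"
      using i1 i2 by auto
    fix u :: "real^'n"
    let ?e = "\<lambda>x. exp (- (\<i> * complex_of_real (u \<bullet> x)))"
    have "fourier (\<lambda>x. \<phi> ((1/2) *\<^sub>R x) - 2 ^ CARD('n) * (\<Sum>k\<in>?K. ?h k * \<phi> (x - real_vec k))) u =
      (LINT x|lebesgue. \<phi> ((1/2) *\<^sub>R x) * ?e x - 2 ^ CARD('n) * (\<Sum>k\<in>?K. ?h k * (\<phi> (x - real_vec k) * ?e x)))"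
      unfolding fourier_def
      by (intro Bochner_Integration.integral_cong) (auto simp: algebra_simps sum_distrib_left sum_distrib_right)
    also have "\<dots> = fourier (\<lambda>x. \<phi> ((1/2) *\<^sub>R x)) u -
      2 ^ CARD('n) * (\<Sum>k\<in>?K. ?h k * fourier (\<lambda>x. \<phi> (x - real_vec k)) u)"
      unfolding fourier_def
      using integrable_fourier_integrand[OF i1, of u] integrable_fourier_integrand[OF i2, of _ u]
      by (subst Bochner_Integration.integral_diff) (auto simp: Bochner_Integration.integral_sum)
    also have "\<dots> = 0"
      unfolding fourier_dilate[OF L1] fourier_translate[OF L1] refinement
      by (simp add: leval_def monom_at_exp_neg sum_distrib_left sum_distrib_right mult_ac)
    finally show "fourier (\<lambda>x. \<phi> ((1/2) *\<^sub>R x) - 2 ^ CARD('n) * (\<Sum>k\<in>?K. ?h k * \<phi> (x - real_vec k))) u = 0" .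
  qed
  then show ?thesis by eventually_elim simp
qed

section \<open>Autocorrelation at integer points\<close>

text \<open>Square integrability enters here, through \<open>|p| |q| \<le> |p|^2 + |q|^2\<close>.
  Integrability of all these products lets finite sums be pulled out of the autocorrelation
  integral.\<close>

lemma integrable_autocorr_integrand:
  fixes \<phi> :: "real ^ 'n \<Rightarrow> complex"
  assumes m: "\<phi> \<in> borel_measurable lebesgue"
    and L2: "integrable lebesgue (\<lambda>x. (norm (\<phi> x))\<^sup>2)"
  shows "integrable lebesgue (\<lambda>x. \<phi> (x - a) * cnj (\<phi> (x - b)))"
proof -
  have m2: "(\<lambda>x. (norm (\<phi> x))\<^sup>2) \<in> borel_measurable lebesgue" using L2 by auto
  have i: "integrable lebesgue (\<lambda>x. (norm (\<phi> (x - a)))\<^sup>2)" for a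
    using integrable_lebesgue_affine[OF _ m2 m2 L2, of 1 "- a"] by simp
  have ms: "(\<lambda>x. \<phi> (x - a)) \<in> borel_measurable lebesgue" for a
  proof -
    have "(\<lambda>x. - a + (\<Sum>j\<in>Basis. (1 * (x \<bullet> j)) *\<^sub>R j)) \<in> lebesgue \<rightarrow>\<^sub>M lebesgue"
      by (rule lebesgue_affine_measurable) auto
    then have "(\<lambda>x. x - a) \<in> lebesgue \<rightarrow>\<^sub>M lebesgue"
      by (simp add: euclidean_representation)
    from measurable_compose[OF this m] show ?thesis .
  qed
  have ms': "(\<lambda>x. cnj (\<phi> (x - a))) \<in> borel_measurable lebesgue" for a
    by (rule measurable_compose[OF ms]) (auto intro!: borel_measurable_continuous_onI continuous_intros)
  show ?thesis
  proof (rule Bochner_Integration.integrable_bound)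
    show "integrable lebesgue (\<lambda>x. (norm (\<phi> (x - a)))\<^sup>2 + (norm (\<phi> (x - b)))\<^sup>2)"
      using i by auto
    show "(\<lambda>x. \<phi> (x - a) * cnj (\<phi> (x - b))) \<in> borel_measurable lebesgue"
      using ms ms' by (rule borel_measurable_times)
    have "norm p * norm q \<le> \<bar>(norm p)\<^sup>2 + (norm q)\<^sup>2\<bar>" for p q :: complex
      using sum_squares_bound[of "norm p" "norm q"] by (auto simp: abs_if) 
    then show "AE x in lebesgue. norm (\<phi> (x - a) * cnj (\<phi> (x - b))) \<le> norm ((norm (\<phi> (x - a)))\<^sup>2 + (norm (\<phi> (x - b)))\<^sup>2)"
      by (auto simp: norm_mult)
  qed
qed

text \<open>Substituting \<open>x/2\<close> in the integral for the autocorrelation at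
  \<open>k\<close> brings in \<open>2^(-d)\<close>, and inserting the refinement equation twice
  brings in \<open>2^(2d)\<close>; this leaves the factor \<open>2^d\<close>. The expanded products
  are again autocorrelation integrands, up to a translation.\<close>

lemma autocorr_refinement:
  fixes \<phi> :: "real ^ 'n \<Rightarrow> complex" and H :: "'n laurent"
  assumes L1: "integrable lebesgue \<phi>"
    and L2: "integrable lebesgue (\<lambda>x. (norm (\<phi> x))\<^sup>2)"
    and refinement: "\<And>u. fourier \<phi> (2 *\<^sub>R u) = leval H (exp_neg u) * fourier \<phi> u"
  shows "autocorr \<phi> (real_vec k) = 2 ^ CARD('n) *
    (\<Sum>m\<in>Poly_Mapping.keys H. \<Sum>n\<in>Poly_Mapping.keys H.
      Poly_Mapping.lookup H m * cnj (Poly_Mapping.lookup H n) * autocorr \<phi> (real_vec (k + k + n - m)))"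
proof -
  let ?K = "Poly_Mapping.keys H" and ?h = "Poly_Mapping.lookup H"
  let ?N = "2 ^ CARD('n) :: complex"
  have m: "\<phi> \<in> borel_measurable lebesgue" using L1 by auto
  define f where "f x = \<phi> ((1/2) *\<^sub>R x)" for x
  define g where "g x = ?N * (\<Sum>k\<in>?K. ?h k * \<phi> (x - real_vec k))" for x
  have ae: "AE x in lebesgue. f x = g x"
    unfolding f_def g_def by (rule refinement_equation_AE[OF L1 refinement])
  have fi: "integrable lebesgue f"
    using integrable_lebesgue_affine[OF _ m m L1, of "1/2" 0] by (simp add: f_def[abs_def])
  have i2: "integrable lebesgue (\<lambda>x. \<phi> (x - real_vec k))" for k
    using integrable_lebesgue_affine[OF _ m m L1, of 1 "- real_vec k"] by simp
  have gi: "integrable lebesgue g"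
    unfolding g_def using i2 by auto
  then have gm: "g \<in> borel_measurable lebesgue" by auto
  \<comment> \<open>The refinement equation holds only almost everywhere but is also needed at
    shifted points; translations preserve null sets.\<close>
  have ae': "AE x in lebesgue. f (x - a) = g (x - a)" for a
    using AE_lebesgue_affine[of 1 f g "-a"] ae fi gi by auto
  \<comment> \<open>A shift by \<open>k\<close> before the dilation is a shift by \<open>2k\<close>
    after it.\<close>
  let ?a = "real_vec k + real_vec k"
  define F where "F x = \<phi> x * cnj (\<phi> (x - real_vec k))" for x
  have Fi: "integrable lebesgue F"
    using integrable_autocorr_integrand[OF m L2, of 0 "real_vec k"] by (simp add: F_def[abs_def])
  have Fm: "F \<in> borel_measurable lebesgue" using Fi by auto
  have F2: "F (0 + (1/2) *\<^sub>R x) = f x * cnj (f (x - ?a))" for x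
  proof -
    have "(1/2) *\<^sub>R x - real_vec k = (1/2) *\<^sub>R (x - ?a)"
      by (simp add: scaleR_diff_right flip: scaleR_2)
    then show ?thesis by (simp add: F_def f_def)
  qed
  \<comment> \<open>Translating by \<open>m\<close> leaves only the relative displacement of the two
    factors, \<open>2k + n - m\<close>.\<close>
  have shift: "(LINT x|lebesgue. \<phi> (x - real_vec m) * cnj (\<phi> (x - (?a + real_vec n)))) =
     autocorr \<phi> (real_vec (k + k + n - m))" for m n
  proof -
    define G where "G x = \<phi> x * cnj (\<phi> (x - real_vec (k + k + n - m)))" for x
    have Gm: "G \<in> borel_measurable lebesgue"
      using integrable_autocorr_integrand[OF m L2, of 0 "real_vec (k + k + n - m)"]
      by (auto simp: G_def[abs_def])
    have "(LINT x|lebesgue. \<phi> (x - real_vec m) * cnj (\<phi> (x - (?a + real_vec n)))) =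
      (LINT x|lebesgue. G (- real_vec m + 1 *\<^sub>R x))"
      unfolding G_def real_vec_add real_vec_diff by (simp add: algebra_simps)
    also have "\<dots> = integral\<^sup>L lebesgue G"
      by (subst lebesgue_integral_affine[OF _ Gm Gm]) auto
    finally show ?thesis unfolding autocorr_def G_def .
  qed
  have "integral\<^sup>L lebesgue F = (LINT x|lebesgue. F (0 + (1/2) *\<^sub>R x)) / ?N"
    by (subst lebesgue_integral_affine[OF _ Fm Fm]) (auto simp: scaleR_conv_of_real power_one_over)
  also have "(LINT x|lebesgue. F (0 + (1/2) *\<^sub>R x)) = (LINT x|lebesgue. g x * cnj (g (x - ?a)))"
  proof (rule integral_cong_AE)
    show "(\<lambda>x. F (0 + (1/2) *\<^sub>R x)) \<in> borel_measurable lebesgue"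
      using integrable_lebesgue_affine[OF _ Fm Fm Fi, of "1/2" 0] by auto
    have c: "cnj \<in> borel_measurable borel" by (auto intro!: borel_measurable_continuous_onI continuous_intros)
    have "integrable lebesgue (\<lambda>x. g (x - ?a))"
      using integrable_lebesgue_affine[OF _ gm gm gi, where c=1 and t="- ?a"] by simp
    then have "(\<lambda>x. cnj (g (x - ?a))) \<in> borel_measurable lebesgue"
      by (rule measurable_compose[OF borel_measurable_integrable c])
    then show "(\<lambda>x. g x * cnj (g (x - ?a))) \<in> borel_measurable lebesgue"
      using gi by (intro borel_measurable_times) auto
    show "AE x in lebesgue. F (0 + (1/2) *\<^sub>R x) = g x * cnj (g (x - ?a))"
      using ae ae'[of ?a] unfolding F2 by eventually_elim simp
  qed
  also have "\<dots> = (LINT x|lebesgue. ?N * ?N * (\<Sum>m\<in>?K. \<Sum>n\<in>?K. (?h m * cnj (?h n)) *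
      (\<phi> (x - real_vec m) * cnj (\<phi> (x - (?a + real_vec n))))))"
  proof (intro Bochner_Integration.integral_cong refl)
    fix x
    have "g x * cnj (g (x - ?a)) = ?N * ?N * ((\<Sum>m\<in>?K. ?h m * \<phi> (x - real_vec m)) *
        (\<Sum>n\<in>?K. cnj (?h n) * cnj (\<phi> (x - ?a - real_vec n))))"
      by (simp add: g_def)
    also have "\<dots> = ?N * ?N * (\<Sum>m\<in>?K. \<Sum>n\<in>?K. (?h m * cnj (?h n)) *
      (\<phi> (x - real_vec m) * cnj (\<phi> (x - (?a + real_vec n)))))"
      unfolding sum_product diff_diff_eq by (simp add: mult_ac)
    finally show "g x * cnj (g (x - ?a)) = \<dots>" .
  qed
  also have "\<dots> = ?N * ?N * (\<Sum>m\<in>?K. \<Sum>n\<in>?K. (?h m * cnj (?h n)) *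
      (LINT x|lebesgue. \<phi> (x - real_vec m) * cnj (\<phi> (x - (?a + real_vec n)))))"
    using integrable_autocorr_integrand[OF m L2] by (simp add: Bochner_Integration.integral_sum)
  finally show ?thesis
    unfolding shift by (simp add: autocorr_def F_def)
qed

subsection \<open>Laurent polynomials and sign flips\<close>

text \<open>The pairing \<open>(-1)^(s . k)\<close>, which is the factor that \<open>z^k\<close>
  picks up under \<open>sign_flip s\<close>. For binary \<open>s\<close> these are the characters of
  \<open>(Z/2)^d\<close>; the symmetry of the pairing allows summation over either argument.\<close>

definition flip_sign :: "int ^ 'n \<Rightarrow> int ^ 'n \<Rightarrow> complex" where
  "flip_sign s k = (\<Prod>i\<in>UNIV. (-1) powi (s $ i * k $ i))"

lemma flip_sign_commute: "flip_sign s k = flip_sign k s"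
  by (simp add: flip_sign_def mult.commute)

lemma torus_nz: "z \<in> torus \<Longrightarrow> z $ i \<noteq> 0"
  by (auto simp: torus_def) (metis norm_zero zero_neq_one)

lemma vec_square_torus: "z \<in> torus \<Longrightarrow> vec_square z \<in> torus"
  by (auto simp: torus_def vec_square_def norm_power)

lemma sign_flip_torus: "z \<in> torus \<Longrightarrow> sign_flip s z \<in> torus"
  by (auto simp: torus_def sign_flip_def norm_mult norm_power_int)

lemma sign_flip_0 [simp]: "sign_flip 0 z = z"
  by (simp add: sign_flip_def vec_eq_iff)

lemma minus_one_powi_even: "(-1) powi n = (if even n then 1 else -1 :: complex)"
  by (simp add: power_int_minus_left)

lemma vec_square_sign_flip: "vec_square (sign_flip s z) = vec_square z"
proof -
  have "((-1) powi n)\<^sup>2 = (1::complex)" for n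
    by (simp add: minus_one_powi_even)
  then show ?thesis by (simp add: vec_square_def sign_flip_def vec_eq_iff power_mult_distrib)
qed

lemma monom_at_0 [simp]: "monom_at z 0 = 1"
  by (simp add: monom_at_def)

lemma monom_at_add: "z \<in> torus \<Longrightarrow> monom_at z (k + l) = monom_at z k * monom_at z l"
  by (simp add: monom_at_def power_int_add torus_nz prod.distrib)

lemma norm_monom_at: "z \<in> torus \<Longrightarrow> norm (monom_at z k) = 1"
  by (simp add: monom_at_def torus_def norm_power_int flip: prod_norm)

lemma monom_at_nz: "z \<in> torus \<Longrightarrow> monom_at z k \<noteq> 0"
  using norm_monom_at[of z k] by auto

lemma monom_at_uminus: "z \<in> torus \<Longrightarrow> monom_at z (- k) = cnj (monom_at z k)"
proof -
  assume z: "z \<in> torus"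
  have "monom_at z (- k) * monom_at z k = 1"
    using monom_at_add[OF z, of "-k" k] by simp
  moreover have "cnj (monom_at z k) * monom_at z k = 1"
    using norm_monom_at[OF z, of k] by (simp add: complex_norm_square[symmetric] mult.commute)
  ultimately show ?thesis using monom_at_nz[OF z, of k]
    by (metis mult_right_cancel)
qed

lemma monom_at_vec_square: "z \<in> torus \<Longrightarrow> monom_at (vec_square z) k = monom_at z (k + k)"
  by (simp only: monom_at_add) (simp add: monom_at_def vec_square_def power2_eq_square power_int_mult_distrib prod.distrib)

lemma monom_at_sign_flip: "monom_at (sign_flip s z) k = flip_sign s k * monom_at z k"
  by (simp add: monom_at_def sign_flip_def flip_sign_def power_int_mult_distrib prod.distrib power_int_mult)

section \<open>Character sums over binary vectors\<close>

text \<open>Distributivity for sums over product sets of vectors. It reduces both the sums over sign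
  vectors and, later, those over grids of roots of unity to one coordinate.\<close>

lemma sum_vec_set:
  fixes A :: "'n::finite \<Rightarrow> 'b set" and f :: "'n \<Rightarrow> 'b \<Rightarrow> 'c :: comm_semiring_1"
  assumes "\<And>i. finite (A i)"
  shows "(\<Sum>v | \<forall>i. v $ i \<in> A i. \<Prod>i\<in>UNIV. f i (v $ i)) = (\<Prod>i\<in>UNIV. \<Sum>x\<in>A i. f i x)"
proof -
  have "(\<Prod>i\<in>UNIV. \<Sum>x\<in>A i. f i x) = (\<Sum>g\<in>PiE UNIV A. \<Prod>i\<in>UNIV. f i (g i))"
    by (rule prod_sum_PiE) (use assms in auto)
  also have "\<dots> = (\<Sum>v | \<forall>i. v $ i \<in> A i. \<Prod>i\<in>UNIV. f i (v $ i))"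
    by (rule sum.reindex_bij_witness[of _ vec_nth vec_lambda]) (auto simp: PiE_iff)
  finally show ?thesis ..
qed

lemma card_vec_set:
  fixes A :: "'n::finite \<Rightarrow> 'b set"
  assumes "\<And>i. finite (A i)"
  shows "finite {v. \<forall>i. v $ i \<in> A i}" "card {v. \<forall>i. v $ i \<in> A i} = (\<Prod>i\<in>UNIV. card (A i))"
proof -
  have *: "{v. \<forall>i. v $ i \<in> A i} = vec_lambda ` PiE UNIV A"
  proof (intro equalityI subsetI)
    fix v assume "v \<in> {v. \<forall>i. v $ i \<in> A i}"
    then show "v \<in> vec_lambda ` PiE UNIV A"
      by (intro image_eqI[of _ _ "vec_nth v"]) auto
  qed auto
  show "finite {v. \<forall>i. v $ i \<in> A i}"
    unfolding * using assms by (intro finite_imageI finite_PiE) auto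
  show "card {v. \<forall>i. v $ i \<in> A i} = (\<Prod>i\<in>UNIV. card (A i))"
    unfolding * by (subst card_image) (auto simp: inj_on_def card_PiE vec_lambda_inject)
qed

lemma finite_binary_vecs [simp]: "finite (binary_vecs :: (int ^ 'n) set)"
  unfolding binary_vecs_def by (rule card_vec_set(1)) auto

lemma zero_in_binary_vecs [simp]: "0 \<in> binary_vecs"
  by (simp add: binary_vecs_def)

text \<open>Coordinate \<open>i\<close> contributes the factor \<open>1 + (-1)^(k_i)\<close>.
  Summing over all sign flips therefore keeps exactly the monomials in \<open>z^2\<close>.\<close>

lemma sum_flip_sign:
  fixes k :: "int ^ 'n"
  shows "(\<Sum>s\<in>binary_vecs. flip_sign s k) = (if k \<in> range (\<lambda>l. l + l) then 2 ^ CARD('n) else 0)"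
proof -
  have "(\<Sum>s\<in>binary_vecs. flip_sign s k) = (\<Prod>i\<in>UNIV. \<Sum>x\<in>{0,1}. (-1) powi (x * k $ i))"
    unfolding binary_vecs_def flip_sign_def by (rule sum_vec_set) auto
  also have "\<dots> = (\<Prod>i\<in>UNIV. if even (k $ i) then 2 else 0)"
    by (rule prod.cong) (auto simp: minus_one_powi_even)
  also have "\<dots> = (if \<forall>i. even (k $ i) then 2 ^ CARD('n) else 0)"
    by (auto simp: prod_zero_iff intro!: prod_zero)
  also have "(\<forall>i. even (k $ i)) \<longleftrightarrow> k \<in> range (\<lambda>l. l + l)"
  proof
    assume "\<forall>i. even (k $ i)"
    then have "k = (\<chi> i. k $ i div 2) + (\<chi> i. k $ i div 2)"
      by (auto simp: vec_eq_iff)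
    then show "k \<in> range (\<lambda>l. l + l)" by blast
  qed auto
  finally show ?thesis .
qed

text \<open>Coordinates of binary vectors differ by at most 1, so an even difference is zero:
  distinct binary vectors lie in distinct cosets of \<open>2 Z^d\<close>.\<close>

lemma binary_vecs_diff_even:
  assumes "j \<in> binary_vecs" "k \<in> binary_vecs"
  shows "k - j \<in> range (\<lambda>l. l + l) \<longleftrightarrow> j = k"
proof
  assume "k - j \<in> range (\<lambda>l. l + l)"
  then obtain l where l: "k - j = l + l" by auto
  have "k $ i = j $ i" for i
  proof -
    have "k $ i - j $ i = l $ i + l $ i" using l by (metis vector_add_component vector_minus_component)
    moreover have "k $ i \<in> {0,1}" "j $ i \<in> {0,1}" using assms by (auto simp: binary_vecs_def)
    ultimately show ?thesis by (auto; presburger)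
  qed
  then show "j = k" by (simp add: vec_eq_iff)
next
  assume "j = k"
  then have "k - j = 0 + 0" by simp
  then show "k - j \<in> range (\<lambda>l. l + l)" by blast
qed

lemma sum_flip_sign_right:
  fixes s :: "int ^ 'n"
  assumes "s \<in> binary_vecs"
  shows "(\<Sum>j\<in>binary_vecs. flip_sign s j) = (if s = 0 then 2 ^ CARD('n) else 0)"
  using sum_flip_sign[of s] binary_vecs_diff_even[OF zero_in_binary_vecs assms]
  by (auto simp: flip_sign_commute[of s])

section \<open>Evaluation of Laurent polynomials\<close>

lemma leval_eq_sum:
  assumes "finite S" "Poly_Mapping.keys P \<subseteq> S"
  shows "leval P z = (\<Sum>k\<in>S. Poly_Mapping.lookup P k * monom_at z k)"
  unfolding leval_def using assms
  by (intro sum.mono_neutral_left) (auto simp: in_keys_iff)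

lemma leval_0 [simp]: "leval 0 z = 0"
  by (simp add: leval_def)

lemma leval_single: "leval (Poly_Mapping.single k c) z = c * monom_at z k"
  by (subst leval_eq_sum[of "{k}"]) auto

lemma leval_add: "leval (P + Q) z = leval P z + leval Q z"
  using keys_add[of P Q]
  by (subst (1 2 3) leval_eq_sum[of "Poly_Mapping.keys P \<union> Poly_Mapping.keys Q"])
    (auto simp: lookup_add algebra_simps sum.distrib)

lemma leval_uminus: "leval (- P) z = - leval P z"
  using leval_add[of P "-P" z] by (simp add: eq_neg_iff_add_eq_0 add.commute)

lemma leval_diff: "leval (P - Q) z = leval P z - leval Q z"
  using leval_add[of P "-Q" z] by (simp add: leval_uminus)

lemma leval_sum: "leval (sum f A) z = (\<Sum>x\<in>A. leval (f x) z)"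
  by (induction A rule: infinite_finite_induct) (auto simp: leval_add)

lemma sum_single_lookup: "P = (\<Sum>k\<in>Poly_Mapping.keys P. Poly_Mapping.single k (Poly_Mapping.lookup P k))"
  by (rule poly_mapping_eqI) (auto simp: lookup_sum lookup_single when_def in_keys_iff)

text \<open>Membership in the torus excludes zero coordinates, at which \<open>powi\<close> is not
  additive in the exponent.\<close>

lemma leval_mult:
  assumes "z \<in> torus"
  shows "leval (P * Q) z = leval P z * leval Q z"
proof -
  have "P * Q = (\<Sum>k\<in>Poly_Mapping.keys P. \<Sum>l\<in>Poly_Mapping.keys Q.
      Poly_Mapping.single (k + l) (Poly_Mapping.lookup P k * Poly_Mapping.lookup Q l))"
    by (subst sum_single_lookup[of P], subst sum_single_lookup[of Q])
      (simp add: sum_product mult_single)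
  then have "leval (P * Q) z = (\<Sum>k\<in>Poly_Mapping.keys P. \<Sum>l\<in>Poly_Mapping.keys Q.
      Poly_Mapping.lookup P k * Poly_Mapping.lookup Q l * monom_at z (k + l))"
    by (simp add: leval_sum leval_single)
  then show ?thesis
    by (simp add: leval_def sum_product monom_at_add[OF assms] mult_ac)
qed

lemma leval_1 [simp]: "leval 1 z = 1"
  using leval_single[of 0 1 z] by simp

lemma leval_power: "z \<in> torus \<Longrightarrow> leval (P ^ n) z = leval P z ^ n"
  by (induction n) (auto simp: leval_mult)

lemma leval_lmonom: "leval (lmonom k) z = monom_at z k"
  by (simp add: lmonom_def leval_single)

lemma leval_lconst: "leval (lconst c) z = c"
  by (simp add: lconst_def leval_single)

lemma leval_lconj: "z \<in> torus \<Longrightarrow> leval (lconj P) z = cnj (leval P z)"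
  unfolding lconj_def leval_sum leval_single by (simp add: monom_at_uminus leval_def)

lemma leval_lsquare_arg: "z \<in> torus \<Longrightarrow> leval (lsquare_arg P) z = leval P (vec_square z)"
  unfolding lsquare_arg_def leval_sum leval_single by (simp only: leval_def monom_at_vec_square)

lemma leval_sign_flip_down:
  assumes "P \<in> laurent_down" "z \<in> torus"
  shows "leval P (sign_flip s z) = leval P z"
  using assms by (auto simp: laurent_down_def leval_lsquare_arg sign_flip_torus vec_square_sign_flip)

subsection \<open>Absolutely summable Laurent series\<close>

text \<open>Terms with equal exponent are grouped by summing over the fibres of \<open>e\<close>,
  which absolute summability permits. Repeated exponents and arbitrary index sets are allowed so
  that products, conjugates, substitution of \<open>z^2\<close> and the Neumann series need no
  explicit formula for their coefficients.\<close>

lemma laurent_l1I: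
  fixes a :: "'i \<Rightarrow> complex" and F :: "complex ^ 'n \<Rightarrow> complex" and e :: "'i \<Rightarrow> int ^ 'n"
  assumes a: "(\<lambda>i. norm (a i)) summable_on I"
    and F: "\<And>z. z \<in> torus \<Longrightarrow> F z = (\<Sum>\<^sub>\<infinity>i\<in>I. a i * monom_at z (e i))"
  shows "F \<in> laurent_l1"
proof -
  define J where "J k = {i \<in> I. e i = k}" for k
  define b where "b k = (\<Sum>\<^sub>\<infinity>i\<in>J k. a i)" for k
  \<comment> \<open>The fibres partition \<open>I\<close>, so sums over \<open>I\<close> become
    iterated sums over the exponent and its fibre.\<close>
  have bij: "bij_betw snd (Sigma UNIV J) I"
    by (rule bij_betwI[where g="\<lambda>i. (e i, i)"]) (auto simp: J_def)
  have s: "(\<lambda>p. norm (a (snd p))) summable_on Sigma UNIV J"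
    using summable_on_reindex_bij_betw[OF bij, of "\<lambda>i. norm (a i)"] a by simp
  have s': "(\<lambda>k. \<Sum>\<^sub>\<infinity>i\<in>J k. norm (a i)) summable_on UNIV"
    using s by (intro summable_on_Sigma_banach) (auto simp: case_prod_unfold)
  have aJ: "(\<lambda>i. norm (a i)) summable_on J k" for k
    using a by (rule summable_on_subset_banach) (auto simp: J_def)
  have "norm (b k) \<le> (\<Sum>\<^sub>\<infinity>i\<in>J k. norm (a i))" for k
    unfolding b_def using aJ[of k] by (rule norm_infsum_bound)
  then have "(\<lambda>k. norm (b k)) summable_on UNIV"
    by (intro summable_on_comparison_test[OF s']) auto
  moreover have "F z = (\<Sum>\<^sub>\<infinity>k\<in>UNIV. b k * monom_at z k)" if z: "z \<in> torus" for z
  proof -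
    have "(\<lambda>p. norm (a (snd p) * monom_at z (e (snd p)))) summable_on Sigma UNIV J"
      using s by (simp add: norm_mult norm_monom_at[OF z])
    then have sm: "(\<lambda>(k, i). a i * monom_at z (e i)) summable_on Sigma UNIV J"
      using abs_summable_summable by (simp add: case_prod_unfold)
    have "F z = (\<Sum>\<^sub>\<infinity>p\<in>Sigma UNIV J. a (snd p) * monom_at z (e (snd p)))"
      unfolding F[OF z] using infsum_reindex_bij_betw[OF bij, of "\<lambda>i. a i * monom_at z (e i)"] by simp
    also have "\<dots> = (\<Sum>\<^sub>\<infinity>k\<in>UNIV. \<Sum>\<^sub>\<infinity>i\<in>J k. a i * monom_at z (e i))"
      using infsum_Sigma'_banach[OF sm] by (simp add: case_prod_unfold)
    also have "\<dots> = (\<Sum>\<^sub>\<infinity>k\<in>UNIV. \<Sum>\<^sub>\<infinity>i\<in>J k. a i * monom_at z k)"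
      by (intro infsum_cong) (auto simp: J_def)
    also have "\<dots> = (\<Sum>\<^sub>\<infinity>k\<in>UNIV. b k * monom_at z k)"
      unfolding b_def
      by (intro infsum_cong infsum_cmult_left) (use aJ abs_summable_summable in blast)
    finally show ?thesis .
  qed
  ultimately show ?thesis unfolding laurent_l1_def by blast
qed

lemma laurent_l1E:
  fixes F :: "complex ^ 'n \<Rightarrow> complex"
  assumes "F \<in> laurent_l1"
  obtains a where "(\<lambda>k. norm (a k)) summable_on UNIV"
    "\<And>z. z \<in> torus \<Longrightarrow> F z = (\<Sum>\<^sub>\<infinity>k\<in>UNIV. a k * monom_at z k)"
    "\<And>z. z \<in> torus \<Longrightarrow> (\<lambda>k. a k * monom_at z k) summable_on UNIV"
proof -
  obtain a where a: "(\<lambda>k. norm (a k)) summable_on UNIV"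
    "\<And>z. z \<in> torus \<Longrightarrow> F z = (\<Sum>\<^sub>\<infinity>k\<in>UNIV. a k * monom_at z k)"
    using assms unfolding laurent_l1_def by blast
  have "(\<lambda>k. a k * monom_at z k) summable_on UNIV" if z: "z \<in> torus" for z
    by (rule abs_summable_summable) (use a(1) in \<open>simp add: norm_mult norm_monom_at[OF z]\<close>)
  with a show ?thesis using that by blast
qed

lemma laurent_l1_cong:
  "F \<in> laurent_l1 \<Longrightarrow> (\<And>z. z \<in> torus \<Longrightarrow> G z = F z) \<Longrightarrow> G \<in> laurent_l1"
  unfolding laurent_l1_def by auto

lemma leval_l1: "leval P \<in> laurent_l1"
  by (rule laurent_l1I[where I="Poly_Mapping.keys P" and a="Poly_Mapping.lookup P" and e="\<lambda>k. k"])
    (auto simp: leval_def)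

lemma laurent_l1_diff:
  fixes F G :: "complex ^ 'n \<Rightarrow> complex"
  assumes "F \<in> laurent_l1" "G \<in> laurent_l1"
  shows "(\<lambda>z. F z - G z) \<in> laurent_l1"
proof -
  obtain a where a: "(\<lambda>k. norm (a k)) summable_on UNIV"
    "\<And>z. z \<in> torus \<Longrightarrow> F z = (\<Sum>\<^sub>\<infinity>k\<in>UNIV. a k * monom_at z k)"
    "\<And>z. z \<in> torus \<Longrightarrow> (\<lambda>k. a k * monom_at z k) summable_on UNIV"
    by (rule laurent_l1E[OF assms(1)]) blast
  obtain b where b: "(\<lambda>k. norm (b k)) summable_on UNIV"
    "\<And>z. z \<in> torus \<Longrightarrow> G z = (\<Sum>\<^sub>\<infinity>k\<in>UNIV. b k * monom_at z k)"
    "\<And>z. z \<in> torus \<Longrightarrow> (\<lambda>k. b k * monom_at z k) summable_on UNIV"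
    by (rule laurent_l1E[OF assms(2)]) blast
  show ?thesis
  proof (rule laurent_l1I[where I=UNIV and e="\<lambda>k. k" and a="\<lambda>k. a k - b k"])
    show "(\<lambda>k. norm (a k - b k)) summable_on UNIV"
      by (rule summable_on_comparison_test[OF summable_on_add[OF a(1) b(1)]]) (auto simp: norm_triangle_ineq4)
    fix z :: "complex^'n" assume z: "z \<in> torus"
    show "F z - G z = (\<Sum>\<^sub>\<infinity>k. (a k - b k) * monom_at z k)"
      using infsum_add[OF a(3)[OF z] summable_on_uminus[THEN iffD2, OF b(3)[OF z]]] a(2)[OF z] b(2)[OF z]
      by (simp add: algebra_simps infsum_uminus)
  qed
qed

text \<open>The doubly indexed family of products of terms is absolutely summable, and
  \<open>laurent_l1I\<close> with exponent \<open>k + l\<close> performs the convolution.\<close>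

lemma laurent_l1_mult:
  fixes F G :: "complex ^ 'n \<Rightarrow> complex"
  assumes "F \<in> laurent_l1" "G \<in> laurent_l1"
  shows "(\<lambda>z. F z * G z) \<in> laurent_l1"
proof -
  obtain a where a: "(\<lambda>k. norm (a k)) summable_on UNIV"
    "\<And>z. z \<in> torus \<Longrightarrow> F z = (\<Sum>\<^sub>\<infinity>k\<in>UNIV. a k * monom_at z k)"
    "\<And>z. z \<in> torus \<Longrightarrow> (\<lambda>k. a k * monom_at z k) summable_on UNIV"
    by (rule laurent_l1E[OF assms(1)]) blast
  obtain b where b: "(\<lambda>k. norm (b k)) summable_on UNIV"
    "\<And>z. z \<in> torus \<Longrightarrow> G z = (\<Sum>\<^sub>\<infinity>k\<in>UNIV. b k * monom_at z k)"
    "\<And>z. z \<in> torus \<Longrightarrow> (\<lambda>k. b k * monom_at z k) summable_on UNIV"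
    by (rule laurent_l1E[OF assms(2)]) blast
  have ab: "(\<lambda>p. norm (a (fst p) * b (snd p))) summable_on UNIV \<times> UNIV"
    unfolding Infinite_Sum.abs_summable_on_Sigma_iff
    using a(1) b(1) summable_on_cmult_right[OF b(1)] summable_on_cmult_left[OF a(1)]
    by (auto simp: norm_mult infsum_cmult_right infsum_nonneg abs_mult)
  show ?thesis
  proof (rule laurent_l1I[where I="UNIV \<times> UNIV" and e="\<lambda>p. fst p + snd p" and a="\<lambda>p. a (fst p) * b (snd p)"])
    show "(\<lambda>p. norm (a (fst p) * b (snd p))) summable_on UNIV \<times> UNIV" by (rule ab)
    fix z :: "complex^'n" assume z: "z \<in> torus"
    have "(\<lambda>p. a (fst p) * b (snd p) * monom_at z (fst p + snd p)) summable_on UNIV \<times> UNIV"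
      by (rule abs_summable_summable) (use ab in \<open>simp add: norm_mult norm_monom_at[OF z]\<close>)
    then have "(\<Sum>\<^sub>\<infinity>p\<in>UNIV \<times> UNIV. a (fst p) * b (snd p) * monom_at z (fst p + snd p)) =
      (\<Sum>\<^sub>\<infinity>k. \<Sum>\<^sub>\<infinity>l. a k * b l * monom_at z (k + l))"
      using infsum_Sigma'_banach[of "\<lambda>k l. a k * b l * monom_at z (k + l)" UNIV "\<lambda>_. UNIV"]
      by (simp add: case_prod_unfold)
    also have "\<dots> = (\<Sum>\<^sub>\<infinity>k. \<Sum>\<^sub>\<infinity>l. (a k * monom_at z k) * (b l * monom_at z l))"
      by (simp add: monom_at_add[OF z] mult_ac)
    also have "\<dots> = F z * G z"
      using a b z by (simp add: infsum_cmult_right infsum_cmult_left)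
    finally show "F z * G z = (\<Sum>\<^sub>\<infinity>p\<in>UNIV \<times> UNIV. a (fst p) * b (snd p) * monom_at z (fst p + snd p))" ..
  qed
qed

lemma laurent_l1_cnj:
  fixes F :: "complex ^ 'n \<Rightarrow> complex"
  assumes "F \<in> laurent_l1"
  shows "(\<lambda>z. cnj (F z)) \<in> laurent_l1"
proof -
  obtain a where a: "(\<lambda>k. norm (a k)) summable_on UNIV"
    "\<And>z. z \<in> torus \<Longrightarrow> F z = (\<Sum>\<^sub>\<infinity>k\<in>UNIV. a k * monom_at z k)"
    "\<And>z. z \<in> torus \<Longrightarrow> (\<lambda>k. a k * monom_at z k) summable_on UNIV"
    by (rule laurent_l1E[OF assms(1)]) blast
  show ?thesis
  proof (rule laurent_l1I[where I=UNIV and e=uminus and a="\<lambda>k. cnj (a k)"])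
    show "(\<lambda>k. norm (cnj (a k))) summable_on UNIV" using a(1) by simp
    fix z :: "complex ^ 'n" assume z: "z \<in> torus"
    show "cnj (F z) = (\<Sum>\<^sub>\<infinity>k. cnj (a k) * monom_at z (- k))"
      unfolding a(2)[OF z] infsum_cnj[symmetric] by (simp add: monom_at_uminus[OF z])
  qed
qed

lemma laurent_l1_down_subset:
  fixes G :: "complex ^ 'n \<Rightarrow> complex"
  assumes "G \<in> laurent_l1_down"
  shows "G \<in> laurent_l1"
proof -
  obtain F where F: "F \<in> laurent_l1" "\<And>z. z \<in> torus \<Longrightarrow> G z = F (vec_square z)"
    using assms unfolding laurent_l1_down_def by auto
  obtain a where a: "(\<lambda>k. norm (a k)) summable_on UNIV"
    "\<And>z. z \<in> torus \<Longrightarrow> F z = (\<Sum>\<^sub>\<infinity>k\<in>UNIV. a k * monom_at z k)"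
    "\<And>z. z \<in> torus \<Longrightarrow> (\<lambda>k. a k * monom_at z k) summable_on UNIV"
    by (rule laurent_l1E[OF F(1)]) blast
  show ?thesis
    by (rule laurent_l1I[OF a(1), where e="\<lambda>k. k + k"])
      (simp only: F(2) a(2) monom_at_vec_square vec_square_torus)
qed

lemma laurent_l1_down_mult:
  assumes "F \<in> laurent_l1_down" "G \<in> laurent_l1_down"
  shows "(\<lambda>z. F z * G z) \<in> laurent_l1_down"
proof -
  obtain F' G' where "F' \<in> laurent_l1" "G' \<in> laurent_l1"
    "\<And>z. z \<in> torus \<Longrightarrow> F z = F' (vec_square z)" "\<And>z. z \<in> torus \<Longrightarrow> G z = G' (vec_square z)"
    using assms unfolding laurent_l1_down_def by auto
  then show ?thesis
    unfolding laurent_l1_down_def by (auto intro!: bexI[OF _ laurent_l1_mult[of F' G']])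
qed

lemma laurent_l1_down_cnj:
  assumes "F \<in> laurent_l1_down"
  shows "(\<lambda>z. cnj (F z)) \<in> laurent_l1_down"
proof -
  obtain F' where "F' \<in> laurent_l1" "\<And>z. z \<in> torus \<Longrightarrow> F z = F' (vec_square z)"
    using assms unfolding laurent_l1_down_def by auto
  then show ?thesis
    unfolding laurent_l1_down_def by (auto intro!: bexI[OF _ laurent_l1_cnj[of F']])
qed

lemma laurent_l1_down_const: "(\<lambda>z. c) \<in> laurent_l1_down"
  unfolding laurent_l1_down_def
  by (auto intro!: bexI[OF _ leval_l1[of "lconst c"]] simp: leval_lconst)

lemma laurent_l1_down_sign_flip:
  assumes "F \<in> laurent_l1_down" "z \<in> torus"
  shows "F (sign_flip s z) = F z"
  using assms by (auto simp: laurent_l1_down_def sign_flip_torus vec_square_sign_flip)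

lemma infsum_finite_sum:
  fixes f :: "'i \<Rightarrow> 'a \<Rightarrow> complex"
  assumes "finite A" "\<And>i. i \<in> A \<Longrightarrow> f i summable_on I"
  shows "(\<Sum>\<^sub>\<infinity>x\<in>I. \<Sum>i\<in>A. f i x) = (\<Sum>i\<in>A. \<Sum>\<^sub>\<infinity>x\<in>I. f i x)"
proof -
  have "(\<lambda>x. \<Sum>i\<in>A. f i x) summable_on I \<and>
      (\<Sum>\<^sub>\<infinity>x\<in>I. \<Sum>i\<in>A. f i x) = (\<Sum>i\<in>A. \<Sum>\<^sub>\<infinity>x\<in>I. f i x)"
    using assms by (induction A rule: finite_induct) (auto simp: summable_on_add infsum_add)
  then show ?thesis ..
qed

text \<open>Only even exponents survive the character sum, and a series with even exponents is a
  series in \<open>z^2\<close>. All membership in the subring that is not obvious comes from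
  here.\<close>

lemma sum_sign_flip_down:
  fixes F :: "complex ^ 'n \<Rightarrow> complex"
  assumes "F \<in> laurent_l1"
  shows "(\<lambda>z. \<Sum>s\<in>binary_vecs. F (sign_flip s z)) \<in> laurent_l1_down"
proof -
  obtain a where a: "(\<lambda>k. norm (a k)) summable_on UNIV"
    "\<And>z. z \<in> torus \<Longrightarrow> F z = (\<Sum>\<^sub>\<infinity>k\<in>UNIV. a k * monom_at z k)"
    "\<And>z. z \<in> torus \<Longrightarrow> (\<lambda>k. a k * monom_at z k) summable_on UNIV"
    by (rule laurent_l1E[OF assms(1)]) blast
  let ?N = "2 ^ CARD('n) :: complex"
  let ?E = "range (\<lambda>l::int^'n. l + l)"
  have inj: "inj (\<lambda>l::int^'n. l + l)" by (auto simp: inj_on_def vec_eq_iff)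
  \<comment> \<open>The surviving coefficient of \<open>z^(2k)\<close> is \<open>2^d\<close> times
    the original one.\<close>
  define G where "G w = (\<Sum>\<^sub>\<infinity>k. (?N * a (k + k)) * monom_at w k)" for w
  have "(\<lambda>k. norm (a k)) summable_on ?E"
    using a(1) by (rule summable_on_subset_banach) auto
  then have "(\<lambda>k. norm (a (k + k))) summable_on UNIV"
    using summable_on_reindex[OF inj, of "\<lambda>k. norm (a k)"] by (simp add: o_def)
  then have "(\<lambda>k. norm (?N * a (k + k))) summable_on UNIV"
    using summable_on_cmult_right by (auto simp: norm_mult)
  then have G: "G \<in> laurent_l1"
    by (rule laurent_l1I[where e="\<lambda>k. k"]) (simp add: G_def)
  have "(\<Sum>s\<in>binary_vecs. F (sign_flip s z)) = G (vec_square z)" if z: "z \<in> torus" for z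
  proof -
    have sm: "(\<lambda>k. a k * monom_at (sign_flip s z) k) summable_on UNIV" for s
      by (rule a(3)[OF sign_flip_torus[OF z]])
    have "(\<Sum>s\<in>binary_vecs. F (sign_flip s z)) = (\<Sum>s\<in>binary_vecs. \<Sum>\<^sub>\<infinity>k. a k * monom_at (sign_flip s z) k)"
      by (simp add: a(2) sign_flip_torus[OF z])
    also have "\<dots> = (\<Sum>\<^sub>\<infinity>k. \<Sum>s\<in>binary_vecs. a k * monom_at (sign_flip s z) k)"
      by (rule infsum_finite_sum[symmetric]) (use sm in auto)
    also have "\<dots> = (\<Sum>\<^sub>\<infinity>k. (\<Sum>s\<in>binary_vecs. flip_sign s k) * (a k * monom_at z k))"
      by (simp add: monom_at_sign_flip sum_distrib_left sum_distrib_right mult_ac)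
    also have "\<dots> = (\<Sum>\<^sub>\<infinity>k\<in>?E. ?N * (a k * monom_at z k))"
      unfolding sum_flip_sign by (rule infsum_cong_neutral) auto
    also have "\<dots> = (\<Sum>\<^sub>\<infinity>k. ?N * (a (k + k) * monom_at z (k + k)))"
      using infsum_reindex[OF inj, of "\<lambda>k. ?N * (a k * monom_at z k)"] by (simp add: o_def)
    also have "\<dots> = G (vec_square z)"
      by (simp add: G_def monom_at_vec_square[OF z] mult_ac)
    finally show ?thesis .
  qed
  then show ?thesis using G unfolding laurent_l1_down_def by blast
qed

section \<open>Inverting a Laurent polynomial that is positive on the torus\<close>

text \<open>A discrete Cauchy estimate: averaging \<open>P(z) z^(-k)\<close> over a sufficiently
  fine grid of roots of unity isolates the coefficient at \<open>k\<close> exactly, so no integral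
  over the torus is involved.\<close>

lemma norm_lookup_le:
  fixes P :: "'n::finite laurent"
  assumes le: "\<And>z. z \<in> torus \<Longrightarrow> norm (leval P z) \<le> r"
  shows "norm (Poly_Mapping.lookup P k) \<le> r"
proof -
  let ?K = "Poly_Mapping.keys P"
  \<comment> \<open>The order \<open>m\<close> exceeds every coordinate of \<open>l - k\<close>, so
    that no nonzero one is divisible by \<open>m\<close> and no other exponent is aliased to
    \<open>k\<close>. Including \<open>k\<close> itself gives \<open>m > 0\<close> and covers
    coefficients outside the support.\<close>
  obtain m :: nat where m: "\<And>l i. l \<in> insert k ?K \<Longrightarrow> \<bar>l $ i - k $ i\<bar> < int m"
  proof -
    define X where "X = (\<lambda>(l, i). \<bar>l $ i - k $ i\<bar>) ` (insert k ?K \<times> UNIV)"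
    have X: "finite X" by (simp add: X_def)
    have "\<bar>l $ i - k $ i\<bar> < int (nat (Max X) + 1)" if "l \<in> insert k ?K" for l i
    proof -
      have "\<bar>l $ i - k $ i\<bar> \<in> X" unfolding X_def using that by force
      from Max_ge[OF X this] show ?thesis by linarith
    qed
    then show ?thesis using that by blast
  qed
  have m0: "m > 0" using m[of k] by auto
  define \<omega> where "\<omega> = exp (2 * of_real pi * \<i> * of_nat 1 / of_nat m)"
  have \<omega>n: "norm \<omega> = 1" by (simp add: \<omega>_def)
  then have \<omega>0: "\<omega> \<noteq> 0" by auto
  have \<omega>m: "\<omega> ^ m = 1" 
    unfolding \<omega>_def exp_of_nat_mult[symmetric] using m0 by (simp add: exp_two_pi_i')
  have \<omega>1: "\<omega> powi n \<noteq> 1" if "0 < \<bar>n\<bar>" "\<bar>n\<bar> < int m" for n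
  proof
    assume eq: "\<omega> powi n = 1"
    have pos: "\<omega> ^ j \<noteq> 1" if "0 < j" "j < m" for j
    proof -
      have "\<omega> ^ j = exp (2 * of_real pi * \<i> * of_nat j / of_nat m)"
        unfolding \<omega>_def exp_of_nat_mult[symmetric] by (simp add: field_simps)
      then show ?thesis
        using complex_root_unity_eq_1[of m j] that nat_dvd_not_less by auto
    qed
    have "\<omega> ^ nat \<bar>n\<bar> = 1"
    proof (cases "n \<ge> 0")
      case False
      have "\<omega> powi (- n) = 1" using eq by (simp add: power_int_minus)
      then show ?thesis using False by (simp add: power_int_def split: if_splits)
    qed (use eq in \<open>simp add: power_int_def\<close>)
    then show False using pos[of "nat \<bar>n\<bar>"] that by auto
  qed
  define T :: "(nat ^ 'n) set" where "T = {t. \<forall>i. t $ i \<in> {..<m}}"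
  have T: "finite T" "card T = m ^ CARD('n)"
    unfolding T_def using card_vec_set[of "\<lambda>_. {..<m}"] by auto
  define w :: "nat ^ 'n \<Rightarrow> complex ^ 'n" where "w t = (\<chi> i. \<omega> ^ (t $ i))" for t
  have w: "w t \<in> torus" for t
    by (simp add: w_def torus_def norm_power \<omega>n)
  \<comment> \<open>In each coordinate this is a geometric sum whose ratio is an \<open>m\<close>-th
    root of unity, equal to 1 only if the exponents agree there.\<close>
  have orth: "(\<Sum>t\<in>T. monom_at (w t) (l - k)) = (if l = k then of_nat m ^ CARD('n) else 0)"
    if l: "l \<in> insert k ?K" for l
  proof -
    have "(\<Sum>t\<in>T. monom_at (w t) (l - k)) = (\<Sum>t\<in>T. \<Prod>i\<in>UNIV. (\<omega> powi (l $ i - k $ i)) ^ (t $ i))"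
      by (simp add: monom_at_def w_def flip: power_int_of_nat power_int_mult) (simp add: mult.commute)
    also have "\<dots> = (\<Prod>i\<in>UNIV. \<Sum>x<m. (\<omega> powi (l $ i - k $ i)) ^ x)"
      unfolding T_def by (rule sum_vec_set) auto
    also have "\<dots> = (\<Prod>i\<in>UNIV. if l $ i = k $ i then of_nat m else 0)"
    proof (rule prod.cong)
      fix i
      show "(\<Sum>x<m. (\<omega> powi (l $ i - k $ i)) ^ x) = (if l $ i = k $ i then of_nat m else 0)"
      proof (cases "l $ i = k $ i")
        case False
        let ?q = "\<omega> powi (l $ i - k $ i)"
        have "?q \<noteq> 1" using \<omega>1[of "l $ i - k $ i"] m[OF l, of i] False by auto
        moreover have "?q ^ m = 1"
          by (metis \<omega>m power_int_1_left power_int_mult power_int_of_nat mult.commute)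
        ultimately show ?thesis using False by (simp add: sum_gp_strict)
      qed simp
    qed simp
    also have "\<dots> = (if l = k then of_nat m ^ CARD('n) else 0)"
      by (auto simp: vec_eq_iff intro!: prod_zero)
    finally show ?thesis .
  qed
  have "(\<Sum>t\<in>T. leval P (w t) * monom_at (w t) (- k)) =
    (\<Sum>t\<in>T. \<Sum>l\<in>insert k ?K. Poly_Mapping.lookup P l * monom_at (w t) (l - k))"
    by (subst leval_eq_sum[of "insert k ?K"])
      (auto simp: sum_distrib_right mult.assoc simp del: sum.insert_if sum.insert simp flip: monom_at_add[OF w])
  also have "\<dots> = (\<Sum>l\<in>insert k ?K. Poly_Mapping.lookup P l * (\<Sum>t\<in>T. monom_at (w t) (l - k)))"
    by (subst sum.swap) (simp only: sum_distrib_left)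
  also have "\<dots> = (\<Sum>l\<in>insert k ?K. if l = k then Poly_Mapping.lookup P l * of_nat m ^ CARD('n) else 0)"
    by (rule sum.cong) (auto simp: orth)
  also have "\<dots> = Poly_Mapping.lookup P k * of_nat m ^ CARD('n)"
    by (subst sum.delta) auto
  finally have "norm (Poly_Mapping.lookup P k) * real m ^ CARD('n) =
     norm (\<Sum>t\<in>T. leval P (w t) * monom_at (w t) (- k))"
    by (simp add: norm_mult norm_power)
  also have "\<dots> \<le> (\<Sum>t\<in>T. r)"
    by (rule order_trans[OF norm_sum sum_mono]) (simp add: norm_mult norm_monom_at[OF w] le[OF w])
  also have "\<dots> = r * real m ^ CARD('n)" by (simp add: T)
  finally show ?thesis using m0 by simp
qed

lemma keys_power_bound:
  fixes P :: "'n::finite laurent"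
  assumes "\<And>k i. k \<in> Poly_Mapping.keys P \<Longrightarrow> \<bar>k $ i\<bar> \<le> int M"
  shows "Poly_Mapping.keys (P ^ n) \<subseteq> {k. \<forall>i. k $ i \<in> {- int (n * M)..int (n * M)}}"
proof (induction n)
  case 0
  then show ?case by (auto split: if_splits)
next
  case (Suc n)
  show ?case
  proof
    fix k assume "k \<in> Poly_Mapping.keys (P ^ Suc n)"
    then obtain a b where ab: "k = a + b" "a \<in> Poly_Mapping.keys P" "b \<in> Poly_Mapping.keys (P ^ n)"
      using keys_mult[of P "P ^ n"] by auto
    have "k $ i \<in> {- int (Suc n * M)..int (Suc n * M)}" for i
    proof -
      have "\<bar>a $ i\<bar> \<le> int M" using assms ab by auto
      moreover have "b $ i \<in> {- int (n * M)..int (n * M)}" using Suc ab by auto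
      ultimately show ?thesis using ab(1) by (auto simp: algebra_simps)
    qed
    then show "k \<in> {k. \<forall>i. k $ i \<in> {- int (Suc n * M)..int (Suc n * M)}}" by simp
  qed
qed

lemma summable_poly_times_geometric:
  assumes "0 \<le> r" "r < 1"
  shows "summable (\<lambda>n. real (2 * (n * M) + 1) ^ N * r ^ n)"
proof (cases "r = 0 \<or> N = 0")
  case True
  then show ?thesis
  proof
    assume "r = 0"
    then show ?thesis
      by (intro summable_finite[of "{0}"]) auto
  qed (use assms in auto)
next
  case False
  \<comment> \<open>One half of \<open>r^n = s^n * s^n\<close> absorbs the polynomial and the other
    stays as a convergent majorant. Taking the \<open>N\<close>-th root \<open>t\<close> of
    \<open>s\<close> reduces the absorption to boundedness of a linear factor times
    \<open>t^n\<close>.\<close>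
  define s where "s = sqrt r"
  have s: "0 < s" "s < 1" "s * s = r" using assms False by (auto simp: s_def)
  define t where "t = root N s"
  have t: "0 < t" "t < 1" "t ^ N = s" using s False by (auto simp: t_def real_root_pow_pos)
  have "(\<lambda>n. (2 * real M) * (real n * t ^ n) + t ^ n) \<longlonglongrightarrow> (2 * real M) * 0 + 0"
    by (intro tendsto_intros powser_times_n_limit_0 LIMSEQ_realpow_zero) (use t in auto)
  then have "(\<lambda>n. real (2 * (n * M) + 1) * t ^ n) \<longlonglongrightarrow> 0"
    by (simp add: algebra_simps)
  then have "Bseq (\<lambda>n. real (2 * (n * M) + 1) * t ^ n)"
    by (intro convergent_imp_Bseq) (auto simp: convergent_def)
  then obtain C where C: "\<And>n. norm (real (2 * (n * M) + 1) * t ^ n) \<le> C"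
    unfolding Bseq_def by blast
  show ?thesis
  proof (rule summable_comparison_test)
    show "summable (\<lambda>n. C ^ N * s ^ n)" using s by (intro summable_mult summable_geometric) auto
    have "norm (real (2 * (n * M) + 1) ^ N * r ^ n) \<le> C ^ N * s ^ n" for n
    proof -
      have "(t ^ n) ^ N = s ^ n" using t(3) by (metis mult.commute power_mult)
      then have "real (2 * (n * M) + 1) ^ N * r ^ n = (real (2 * (n * M) + 1) * t ^ n) ^ N * s ^ n"
        by (simp add: power_mult_distrib flip: s(3))
      also have "\<dots> \<le> C ^ N * s ^ n"
        using C[of n] s t by (intro mult_right_mono power_mono) (auto simp del: of_nat_add of_nat_mult)
      finally show ?thesis using assms by simp
    qed
    then show "\<exists>N0. \<forall>n\<ge>N0. norm (real (2 * (n * M) + 1) ^ N * r ^ n) \<le> C ^ N * s ^ n" by blast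
  qed
qed

text \<open>Neumann series. The powers of a Laurent polynomial have supports of polynomial size, so the
  \<open>\<ell>\<^sub>1\<close>-norm of their coefficients decays geometrically along with their supremum norm; no appeal
  to Wiener's lemma is needed.\<close>

lemma inverse_one_minus_l1:
  fixes P :: "'n::finite laurent"
  assumes le: "\<And>z. z \<in> torus \<Longrightarrow> norm (leval P z) \<le> r" and r: "0 \<le> r" "r < 1"
  shows "(\<lambda>z. 1 / (1 - leval P z)) \<in> laurent_l1"
proof -
  obtain M where M: "\<And>k i. k \<in> Poly_Mapping.keys P \<Longrightarrow> \<bar>k $ i\<bar> \<le> int M"
  proof -
    define X where "X = (\<lambda>(k, i). \<bar>k $ i\<bar>) ` (Poly_Mapping.keys P \<times> UNIV)"
    have X: "finite X" by (simp add: X_def)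
    have "\<bar>k $ i\<bar> \<le> int (nat (Max X))" if "k \<in> Poly_Mapping.keys P" for k i
    proof -
      have "\<bar>k $ i\<bar> \<in> X" unfolding X_def using that by force
      from Max_ge[OF X this] show ?thesis by linarith
    qed
    then show ?thesis using that by blast
  qed
  define a where "a n k = Poly_Mapping.lookup (P ^ n) k" for n k
  have fin: "(\<lambda>k. norm (a n k)) summable_on UNIV" for n
    by (rule finite_nonzero_values_imp_summable_on) (simp add: a_def)
  have bound: "(\<Sum>\<^sub>\<infinity>k. norm (a n k)) \<le> real (2 * (n * M) + 1) ^ CARD('n) * r ^ n" for n
  proof -
    let ?B = "{k::int^'n. \<forall>i. k $ i \<in> {- int (n * M)..int (n * M)}}"
    have B: "finite ?B" "card ?B = (2 * (n * M) + 1) ^ CARD('n)"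
      by (subst card_vec_set | simp add: card_vec_set nat_add_distrib nat_mult_distrib algebra_simps)+
    have "a n k = 0" if "k \<notin> ?B" for k
      using keys_power_bound[of P M n] M that unfolding a_def by (metis (no_types, lifting) in_keys_iff subsetD)
    then have "(\<Sum>\<^sub>\<infinity>k. norm (a n k)) = (\<Sum>\<^sub>\<infinity>k\<in>?B. norm (a n k))"
      by (intro infsum_cong_neutral) auto
    also have "\<dots> = (\<Sum>k\<in>?B. norm (a n k))" using B by simp
    also have "\<dots> \<le> (\<Sum>k\<in>?B. r ^ n)"
      unfolding a_def using le r
      by (intro sum_mono norm_lookup_le) (simp add: leval_power norm_power power_mono)
    finally show ?thesis using B by simp
  qed
  have "(\<lambda>n. \<Sum>\<^sub>\<infinity>k. norm (a n k)) summable_on UNIV"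
  proof (rule summable_on_comparison_test)
    show "(\<lambda>n. real (2 * (n * M) + 1) ^ CARD('n) * r ^ n) summable_on UNIV"
    proof (rule norm_summable_imp_summable_on)
      have "norm (real (2 * (n * M) + 1) ^ CARD('n) * r ^ n) = real (2 * (n * M) + 1) ^ CARD('n) * r ^ n" for n
        using r by simp
      then show "summable (\<lambda>n. norm (real (2 * (n * M) + 1) ^ CARD('n) * r ^ n))"
        using summable_poly_times_geometric[OF r, of M "CARD('n)"] by (simp only:)
    qed
  qed (use bound in \<open>auto intro: infsum_nonneg\<close>)
  \<comment> \<open>Summability over power and exponent jointly allows \<open>laurent_l1I\<close> to
    collect the coefficients of all powers at once.\<close>
  then have s: "(\<lambda>p. norm (a (fst p) (snd p))) summable_on UNIV \<times> UNIV"
    unfolding Infinite_Sum.abs_summable_on_Sigma_iff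
    using fin by (auto simp: infsum_nonneg)
  show ?thesis
  proof (rule laurent_l1I[OF s, where e=snd])
    fix z :: "complex^'n" assume z: "z \<in> torus"
    have pow: "(\<Sum>\<^sub>\<infinity>k. a n k * monom_at z k) = leval P z ^ n" for n
    proof -
      have "(\<Sum>\<^sub>\<infinity>k. a n k * monom_at z k) = (\<Sum>\<^sub>\<infinity>k\<in>Poly_Mapping.keys (P ^ n). a n k * monom_at z k)"
        by (intro infsum_cong_neutral) (auto simp: a_def in_keys_iff)
      then show ?thesis
        unfolding leval_power[OF z, symmetric] by (simp add: a_def leval_def)
    qed
    have n: "norm (leval P z) < 1" using le[OF z] r by simp
    have "((\<lambda>n. leval P z ^ n) has_sum (1 / (1 - leval P z))) UNIV"
      by (rule norm_summable_imp_has_sum) (use n geometric_sums[OF n] in \<open>simp_all add: norm_power\<close>)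
    then have geo: "(\<Sum>\<^sub>\<infinity>n. leval P z ^ n) = 1 / (1 - leval P z)" by (rule infsumI)
    have "(\<lambda>p. a (fst p) (snd p) * monom_at z (snd p)) summable_on UNIV \<times> UNIV"
      by (rule abs_summable_summable) (use s in \<open>simp add: norm_mult norm_monom_at[OF z]\<close>)
    then have "(\<Sum>\<^sub>\<infinity>n. \<Sum>\<^sub>\<infinity>k. a n k * monom_at z k) =
        (\<Sum>\<^sub>\<infinity>p\<in>UNIV \<times> UNIV. a (fst p) (snd p) * monom_at z (snd p))"
      using infsum_Sigma'_banach[of "\<lambda>n k. a n k * monom_at z k" UNIV "\<lambda>_. UNIV"]
      by (simp add: case_prod_unfold)
    then show "1 / (1 - leval P z) = (\<Sum>\<^sub>\<infinity>p\<in>UNIV \<times> UNIV. a (fst p) (snd p) * monom_at z (snd p))"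
      unfolding pow geo .
  qed
qed

text \<open>The polynomial \<open>Q = 1 - P / B\<close> takes values between 0 and
  \<open>1 - A / B < 1\<close> on the torus, so the Neumann series applies to
  \<open>1 / P = (1 / B) / (1 - Q)\<close>.\<close>

lemma inverse_positive_l1:
  fixes P :: "'n::finite laurent"
  assumes A: "A > 0"
    and bounds: "\<And>z. z \<in> torus \<Longrightarrow> leval P z \<in> \<real> \<and> A \<le> Re (leval P z) \<and> Re (leval P z) \<le> B"
  shows "(\<lambda>z. 1 / leval P z) \<in> laurent_l1"
proof -
  \<comment> \<open>The bounds at one point of the torus give \<open>A \<le> B\<close>, and hence
    \<open>B > 0\<close>.\<close>
  have "(1 :: complex^'n) \<in> torus" by (simp add: torus_def)
  then have AB: "A \<le> B" using bounds by fastforce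
  define Q where "Q = 1 - lconst (1 / of_real B) * P"
  have Q: "leval Q z = of_real (1 - Re (leval P z) / B)" if "z \<in> torus" for z
    using bounds[OF that] that by (auto simp: Q_def leval_diff leval_mult leval_lconst elim!: Reals_cases)
  have "(\<lambda>z. 1 / (1 - leval Q z)) \<in> laurent_l1"
  proof (rule inverse_one_minus_l1)
    show "norm (leval Q z) \<le> 1 - A / B" if "z \<in> torus" for z
      unfolding Q[OF that] norm_of_real using bounds[OF that] A AB
      by (simp add: divide_right_mono abs_if)
  qed (use A AB in auto)
  from laurent_l1_mult[OF leval_l1[of "lconst (1 / of_real B)"] this] show ?thesis
    by (rule laurent_l1_cong)
      (use A AB in \<open>simp add: Q_def leval_diff leval_mult leval_lconst\<close>)
qed

subsection \<open>Orthogonality and the basis property\<close>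

text \<open>In the expanded bracket the term \<open>z^(l + m - n)\<close> survives the sum over sign
  flips only if its exponent is some \<open>2k\<close>, that is, \<open>l = 2k + n - m\<close>. The
  resulting coefficient of \<open>z^(2k)\<close> is the right-hand side of
  \<open>autocorr_refinement\<close> at \<open>k\<close>.\<close>

lemma bracket_refinement:
  fixes \<phi> :: "real ^ 'n \<Rightarrow> complex" and H \<Phi> :: "'n laurent"
  assumes L1: "integrable lebesgue \<phi>"
    and L2: "integrable lebesgue (\<lambda>x. (norm (\<phi> x))\<^sup>2)"
    and refinement: "\<And>u. fourier \<phi> (2 *\<^sub>R u) = leval H (exp_neg u) * fourier \<phi> u"
    and Phi: "\<And>k. Poly_Mapping.lookup \<Phi> k = autocorr \<phi> (real_vec k)"
    and z: "z \<in> torus"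
  shows "bracket (leval \<Phi>) (leval H) (leval H) z = leval \<Phi> (vec_square z)"
proof -
  let ?K = "Poly_Mapping.keys H" and ?L = "Poly_Mapping.keys \<Phi>"
  let ?h = "Poly_Mapping.lookup H" and ?p = "Poly_Mapping.lookup \<Phi>"
  let ?N = "2 ^ CARD('n) :: complex"
  define X where "X m n = {k. k + k + n - m \<in> ?L}" for m n
  have inj: "inj (\<lambda>k. k + k + n - m)" for m n :: "int^'n"
    by (auto simp: inj_on_def vec_eq_iff)
  have X: "finite (X m n)" for m n
    using finite_vimageI[OF finite_keys[of \<Phi>] inj[where n=n and m=m]] by (simp add: X_def vimage_def)
  \<comment> \<open>One finite range of \<open>k\<close> that serves every pair \<open>m\<close>,
    \<open>n\<close> as well as the support of \<open>\<Phi>\<close>, so that the sum over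
    \<open>k\<close> can be moved outside.\<close>
  define U where "U = ?L \<union> (\<Union>m\<in>?K. \<Union>n\<in>?K. X m n)"
  have U: "finite U" "?L \<subseteq> U" "\<And>m n. m \<in> ?K \<Longrightarrow> n \<in> ?K \<Longrightarrow> X m n \<subseteq> U"
    using X by (auto simp: U_def)
  have inner: "(\<Sum>l\<in>?L. ?p l * ((\<Sum>s\<in>binary_vecs. flip_sign s (l + m - n)) * monom_at z (l + m - n))) =
    ?N * (\<Sum>k\<in>U. ?p (k + k + n - m) * monom_at z (k + k))" if mn: "m \<in> ?K" "n \<in> ?K" for m n
  proof -
    have img: "(\<lambda>k. k + k + n - m) ` X m n = {l \<in> ?L. l + m - n \<in> range (\<lambda>k. k + k)}"
    proof (intro equalityI subsetI)
      fix l assume "l \<in> {l \<in> ?L. l + m - n \<in> range (\<lambda>k. k + k)}"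
      then obtain k where k: "l + m - n = k + k" "l \<in> ?L" by blast
      then have "l = k + k + n - m" by (metis add_diff_cancel_right' diff_add_cancel)
      then show "l \<in> (\<lambda>k. k + k + n - m) ` X m n" using k by (auto simp: X_def)
    next
      fix l assume "l \<in> (\<lambda>k. k + k + n - m) ` X m n"
      then obtain k where k: "l = k + k + n - m" "l \<in> ?L" by (auto simp: X_def)
      then have "l + m - n = k + k" by (simp only: diff_add_cancel add_diff_cancel_right')
      then show "l \<in> {l \<in> ?L. l + m - n \<in> range (\<lambda>k. k + k)}" using k by blast
    qed
    have "(\<Sum>l\<in>?L. ?p l * ((\<Sum>s\<in>binary_vecs. flip_sign s (l + m - n)) * monom_at z (l + m - n))) =
      (\<Sum>l\<in>?L. if l + m - n \<in> range (\<lambda>k. k + k) then ?N * (?p l * monom_at z (l + m - n)) else 0)"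
      unfolding sum_flip_sign by (intro sum.cong) auto
    also have "\<dots> = (\<Sum>l\<in>(\<lambda>k. k + k + n - m) ` X m n. ?N * (?p l * monom_at z (l + m - n)))"
      unfolding img by (rule sum.inter_filter[symmetric]) simp
    also have "\<dots> = (\<Sum>k\<in>X m n. ?N * (?p (k + k + n - m) * monom_at z (k + k + n - m + m - n)))"
      by (subst sum.reindex[OF inj_on_subset[OF inj]]) (simp_all only: subset_UNIV o_def)
    also have "\<dots> = (\<Sum>k\<in>X m n. ?N * (?p (k + k + n - m) * monom_at z (k + k)))"
      by (simp only: diff_add_cancel add_diff_cancel_right')
    also have "\<dots> = (\<Sum>k\<in>U. ?N * (?p (k + k + n - m) * monom_at z (k + k)))"
      by (intro sum.mono_neutral_left U mn) (auto simp: X_def in_keys_iff)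
    finally show ?thesis by (simp only: sum_distrib_left)
  qed
  have "bracket (leval \<Phi>) (leval H) (leval H) z =
    (\<Sum>s\<in>binary_vecs. \<Sum>m\<in>?K. \<Sum>n\<in>?K. \<Sum>l\<in>?L. ?h m * cnj (?h n) * ?p l * monom_at (sign_flip s z) (l + m - n))"
    unfolding bracket_def
  proof (rule sum.cong)
    fix s
    have w: "sign_flip s z \<in> torus" by (rule sign_flip_torus[OF z])
    have "leval \<Phi> (sign_flip s z) * leval H (sign_flip s z) * cnj (leval H (sign_flip s z)) =
      (\<Sum>m\<in>?K. ?h m * monom_at (sign_flip s z) m) * ((\<Sum>n\<in>?K. cnj (?h n) * monom_at (sign_flip s z) (- n)) *
      (\<Sum>l\<in>?L. ?p l * monom_at (sign_flip s z) l))"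
      by (simp add: leval_def monom_at_uminus[OF w])
    also have "\<dots> = (\<Sum>m\<in>?K. \<Sum>n\<in>?K. \<Sum>l\<in>?L. ?h m * monom_at (sign_flip s z) m * (cnj (?h n) * monom_at (sign_flip s z) (- n) *
      (?p l * monom_at (sign_flip s z) l)))"
      by (simp only: sum_product, simp only: sum_distrib_left)
    also have "\<dots> = (\<Sum>m\<in>?K. \<Sum>n\<in>?K. \<Sum>l\<in>?L. ?h m * cnj (?h n) * ?p l * monom_at (sign_flip s z) (l + m - n))"
      by (intro sum.cong refl) (simp only: diff_conv_add_uminus monom_at_add[OF w] mult_ac)
    finally show "leval \<Phi> (sign_flip s z) * leval H (sign_flip s z) * cnj (leval H (sign_flip s z)) = \<dots>" .
  qed simp
  also have "\<dots> = (\<Sum>m\<in>?K. \<Sum>n\<in>?K. \<Sum>l\<in>?L. \<Sum>s\<in>binary_vecs. ?h m * cnj (?h n) * ?p l * monom_at (sign_flip s z) (l + m - n))"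
    by (simp only: sum.swap[of _ _ "binary_vecs"])
  also have "\<dots> = (\<Sum>m\<in>?K. \<Sum>n\<in>?K. ?h m * cnj (?h n) *
      (\<Sum>l\<in>?L. ?p l * ((\<Sum>s\<in>binary_vecs. flip_sign s (l + m - n)) * monom_at z (l + m - n))))"
    by (simp only: monom_at_sign_flip sum_distrib_left sum_distrib_right mult.assoc)
  also have "\<dots> = (\<Sum>m\<in>?K. \<Sum>n\<in>?K. ?h m * cnj (?h n) * (?N * (\<Sum>k\<in>U. ?p (k + k + n - m) * monom_at z (k + k))))"
    by (intro sum.cong refl) (simp only: inner)
  also have "\<dots> = (\<Sum>m\<in>?K. \<Sum>n\<in>?K. \<Sum>k\<in>U. ?N * (?h m * cnj (?h n) * ?p (k + k + n - m)) * monom_at z (k + k))"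
    by (simp only: sum_distrib_left mult_ac)
  also have "\<dots> = (\<Sum>k\<in>U. \<Sum>m\<in>?K. \<Sum>n\<in>?K. ?N * (?h m * cnj (?h n) * ?p (k + k + n - m)) * monom_at z (k + k))"
    by (simp only: sum.swap[of _ U])
  also have "\<dots> = (\<Sum>k\<in>U. ?p k * monom_at z (k + k))"
  proof (rule sum.cong)
    fix k
    show "(\<Sum>m\<in>?K. \<Sum>n\<in>?K. ?N * (?h m * cnj (?h n) * ?p (k + k + n - m)) * monom_at z (k + k)) = ?p k * monom_at z (k + k)"
      unfolding Phi autocorr_refinement[OF L1 L2 refinement, of k]
      by (simp only: sum_distrib_left sum_distrib_right)
  qed simp
  also have "\<dots> = leval \<Phi> (vec_square z)"
    by (subst leval_eq_sum[OF U(1,2)]) (simp only: monom_at_vec_square[OF z])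
  finally show ?thesis .
qed

section \<open>Polyphase components\<close>

lemma sum_monom_sign_flip_diff:
  fixes z :: "complex ^ 'n"
  assumes "j \<in> binary_vecs" "k \<in> binary_vecs"
  shows "(\<Sum>s\<in>binary_vecs. monom_at (sign_flip s z) (k - j)) = (if j = k then 2 ^ CARD('n) else 0)"
proof -
  have "(\<Sum>s\<in>binary_vecs. monom_at (sign_flip s z) (k - j)) = (\<Sum>s\<in>binary_vecs. flip_sign s (k - j)) * monom_at z (k - j)"
    by (simp add: monom_at_sign_flip sum_distrib_right)
  then show ?thesis using binary_vecs_diff_even[OF assms] unfolding sum_flip_sign by auto
qed

text \<open>The left side is the same for all sign flips, so it has only a component at exponent 0,
  while the right side has only components at exponents \<open>- i\<close> with \<open>i\<close>
  nonzero. Multiplying by the flipped \<open>z^j\<close> and summing over the flips annihilates the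
  left side and isolates \<open>x j\<close>.\<close>

lemma sign_flip_independent:
  fixes z :: "complex ^ 'n"
  assumes z: "z \<in> torus"
    and eq: "\<And>s. C = \<delta> * (\<Sum>i\<in>binary_vecs - {0}. x i * monom_at (sign_flip s z) (- i))"
    and \<delta>: "\<delta> \<noteq> 0" and j: "j \<in> binary_vecs - {0}"
  shows "x j = 0"
proof -
  have diff: "monom_at (sign_flip s z) (j - i) = monom_at (sign_flip s z) j * monom_at (sign_flip s z) (- i)" for s i
    unfolding diff_conv_add_uminus by (rule monom_at_add[OF sign_flip_torus[OF z]])
  have "0 = C * (\<Sum>s\<in>binary_vecs. monom_at (sign_flip s z) (j - 0))"
    using sum_monom_sign_flip_diff[of 0 j z] j by auto
  also have "\<dots> = (\<Sum>s\<in>binary_vecs. C * monom_at (sign_flip s z) j)"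
    by (simp add: sum_distrib_left)
  also have "\<dots> = (\<Sum>s\<in>binary_vecs. \<Sum>i\<in>binary_vecs - {0}. \<delta> * x i * monom_at (sign_flip s z) (j - i))"
  proof (rule sum.cong[OF refl])
    fix s :: "int ^ 'n"
    show "C * monom_at (sign_flip s z) j = (\<Sum>i\<in>binary_vecs - {0}. \<delta> * x i * monom_at (sign_flip s z) (j - i))"
      by (subst eq[of s]) (simp only: diff sum_distrib_left sum_distrib_right mult_ac)
  qed
  also have "\<dots> = (\<Sum>i\<in>binary_vecs - {0}. \<delta> * x i * (\<Sum>s\<in>binary_vecs. monom_at (sign_flip s z) (j - i)))"
    by (subst sum.swap) (simp only: sum_distrib_left)
  also have "\<dots> = (\<Sum>i\<in>binary_vecs - {0}. if i = j then \<delta> * x i * 2 ^ CARD('n) else 0)"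
    using j by (intro sum.cong refl) (auto simp: sum_monom_sign_flip_diff)
  also have "\<dots> = \<delta> * x j * 2 ^ CARD('n)" using j by (subst sum.delta) auto
  finally show ?thesis using \<delta> by simp
qed

text \<open>Inversion of the Fourier transform on \<open>(Z/2)^d\<close>: the inner sum is
  \<open>2^d\<close> times the component of \<open>G\<close> at \<open>z^(-j)\<close>. Negative
  exponents are used because \<open>D_j\<close> contains \<open>z^(-j)\<close>.\<close>

lemma polyphase_expansion:
  fixes z :: "complex ^ 'n"
  assumes z: "z \<in> torus"
  shows "(\<Sum>j\<in>binary_vecs. (\<Sum>s\<in>binary_vecs. G (sign_flip s z) * monom_at (sign_flip s z) j) * monom_at z (- j))
    = 2 ^ CARD('n) * G z"
proof -
  have inv: "monom_at z j * monom_at z (- j) = 1" for j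
    using monom_at_add[OF z, of j "- j"] by simp
  have "(\<Sum>j\<in>binary_vecs. (\<Sum>s\<in>binary_vecs. G (sign_flip s z) * monom_at (sign_flip s z) j) * monom_at z (- j)) =
    (\<Sum>j\<in>binary_vecs. \<Sum>s\<in>binary_vecs. G (sign_flip s z) * flip_sign s j)"
    using inv by (simp add: monom_at_sign_flip sum_distrib_right mult.assoc)
  also have "\<dots> = (\<Sum>s\<in>binary_vecs. G (sign_flip s z) * (\<Sum>j\<in>binary_vecs. flip_sign s j))"
    by (subst sum.swap) (simp only: sum_distrib_left)
  also have "\<dots> = (\<Sum>s\<in>(binary_vecs :: (int ^ 'n) set). if s = 0 then G z * 2 ^ CARD('n) else 0)"
    by (rule sum.cong) (auto simp: sum_flip_sign_right)
  also have "\<dots> = 2 ^ CARD('n) * G z" by (simp add: sum.delta)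
  finally show ?thesis .
qed

lemma bracket_down:
  assumes "F \<in> laurent_l1" "G \<in> laurent_l1" "P \<in> laurent_l1"
  shows "bracket P F G \<in> laurent_l1_down"
proof -
  have "(\<lambda>w. P w * F w * cnj (G w)) \<in> laurent_l1"
    by (intro laurent_l1_mult laurent_l1_cnj assms)
  from sum_sign_flip_down[OF this] show ?thesis by (simp only: bracket_def[abs_def])
qed

text \<open>The form is Hermitian because its weight is real on the torus. This transfers
  orthogonality from one slot to the other.\<close>

lemma bracket_cnj:
  assumes "\<And>w. w \<in> torus \<Longrightarrow> P w \<in> \<real>" "z \<in> torus"
  shows "cnj (bracket P F G z) = bracket P G F z"
  unfolding bracket_def cnj_sum
proof (rule sum.cong[OF refl])
  fix s
  have "cnj (P (sign_flip s z)) = P (sign_flip s z)"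
    using assms(1)[OF sign_flip_torus[OF assms(2)]] by (simp only: Reals_cnj_iff)
  then show "cnj (P (sign_flip s z) * F (sign_flip s z) * cnj (G (sign_flip s z))) =
      P (sign_flip s z) * G (sign_flip s z) * cnj (F (sign_flip s z))"
    by simp
qed

theorem proposition4p7:
  fixes \<phi> :: "real ^ 'n \<Rightarrow> complex"
    and H \<Phi> V D :: "'n laurent"
    and d D' H' :: "int ^ 'n \<Rightarrow> 'n laurent"
    and A B :: real and c :: complex
  assumes L1: "integrable lebesgue \<phi>"
    and L2: "integrable lebesgue (\<lambda>x. (norm (\<phi> x))\<^sup>2)"
    and refinement: "\<And>u. fourier \<phi> (2 *\<^sub>R u) = leval H (exp_neg u) * fourier \<phi> u"
    and Phi: "\<And>k. Poly_Mapping.lookup \<Phi> k = autocorr \<phi> (\<chi> i. real_of_int (k $ i))"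
    and AB: "A > 0" "B > 0"
    and bounds: "\<And>z. z \<in> torus \<Longrightarrow> leval \<Phi> z \<in> \<real> \<and> A \<le> Re (leval \<Phi> z) \<and> Re (leval \<Phi> z) \<le> B"
    and c: "c \<noteq> 0"
    and V: "invertible_in laurent_l1 (leval V)"
    and D: "D = lconst c * H * \<Phi> * V"
    and d_down: "\<And>j. j \<in> binary_vecs \<Longrightarrow> d j \<in> laurent_down"
    and D_poly: "D = (\<Sum>j\<in>binary_vecs. d j * lmonom j)"
    and d0_nz: "d 0 \<noteq> 0"
    and d0: "invertible_in laurent_l1_down (leval (d 0))"
    and D': "\<And>j. j \<in> binary_vecs - {0} \<Longrightarrow> D' j = d j - d 0 * lmonom (- j)"
    and H': "\<And>j. j \<in> binary_vecs - {0} \<Longrightarrow> H' j = lconj (V * D' j)"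
  shows "(\<forall>j\<in>binary_vecs - {0}. \<forall>z\<in>torus. bracket (leval \<Phi>) (leval H) (leval (H' j)) z = 0) \<and>
    is_basis_over laurent_l1_down laurent_l1 binary_vecs
      (\<lambda>j. leval (if j = 0 then H else H' j))"
proof -
  let ?N = "2 ^ CARD('n) :: complex"
  let ?E = "binary_vecs :: (int ^ 'n) set"
  let ?br = "bracket (leval \<Phi>)"
  define b where "b j = leval (if j = 0 then H else H' j)" for j
  have b0: "b 0 = leval H" by (simp add: b_def)
  have Phi_nz: "leval \<Phi> z \<noteq> 0" if "z \<in> torus" for z
    using bounds[OF that] AB by auto
  have Phi_real: "leval \<Phi> z \<in> \<real>" if "z \<in> torus" for z
    using bounds[OF that] by auto
  have HH: "?br (leval H) (leval H) z = leval \<Phi> (vec_square z)" if "z \<in> torus" for z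
    using bracket_refinement[OF L1 L2 refinement _ that] Phi by (simp add: real_vec_def)
  obtain W where W: "W \<in> laurent_l1" "\<And>z. z \<in> torus \<Longrightarrow> leval V z * W z = 1"
    using V unfolding invertible_in_def by blast
  obtain U where U: "U \<in> laurent_l1_down" "\<And>z. z \<in> torus \<Longrightarrow> leval (d 0) z * U z = 1"
    using d0 unfolding invertible_in_def by blast
  have V_nz: "leval V z \<noteq> 0" if "z \<in> torus" for z using W(2)[OF that] by auto
  have d0_eval: "leval (d 0) z \<noteq> 0" if "z \<in> torus" for z using U(2)[OF that] by auto
  have flip: "leval (d j) (sign_flip s z) = leval (d j) z" if "j \<in> ?E" "z \<in> torus" for j s z
    by (rule leval_sign_flip_down[OF d_down[OF that(1)] that(2)])
  have D_eval: "leval D z = c * leval H z * leval \<Phi> z * leval V z" if "z \<in> torus" for z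
    using that by (simp add: D leval_mult leval_lconst)
  have D_eval2: "leval D z = (\<Sum>j\<in>?E. leval (d j) z * monom_at z j)" if "z \<in> torus" for z
    using that by (simp add: D_poly leval_sum leval_mult leval_lmonom)
  have b_eval: "b j z = cnj (leval V z * (leval (d j) z - leval (d 0) z * monom_at z (- j)))"
    if "j \<in> ?E - {0}" "z \<in> torus" for j z
    using that by (simp add: b_def H' D' leval_lconj leval_mult leval_diff leval_lmonom)
  have avg_D: "(\<Sum>s\<in>?E. leval D (sign_flip s z) * monom_at (sign_flip s z) (- j)) = ?N * leval (d j) z"
    if j: "j \<in> ?E" and z: "z \<in> torus" for j z
  proof -
    have "(\<Sum>s\<in>?E. leval D (sign_flip s z) * monom_at (sign_flip s z) (- j)) =
      (\<Sum>s\<in>?E. \<Sum>k\<in>?E. leval (d k) z * monom_at (sign_flip s z) (k - j))"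
      using z by (simp add: D_eval2 sign_flip_torus flip sum_distrib_right mult.assoc
          diff_conv_add_uminus monom_at_add del: add_uminus_conv_diff)
    also have "\<dots> = (\<Sum>k\<in>?E. leval (d k) z * (\<Sum>s\<in>?E. monom_at (sign_flip s z) (k - j)))"
      by (subst sum.swap) (simp only: sum_distrib_left)
    also have "\<dots> = (\<Sum>k\<in>?E. if k = j then leval (d k) z * ?N else 0)"
      using j by (intro sum.cong refl) (auto simp: sum_monom_sign_flip_diff)
    also have "\<dots> = ?N * leval (d j) z" using j by (simp add: sum.delta)
    finally show ?thesis .
  qed
  have orth: "?br (leval H) (b j) z = 0" if j: "j \<in> ?E - {0}" and z: "z \<in> torus" for j z
  proof -
    \<comment> \<open>The conjugation in the second slot undoes the one in \<open>H_j\<close>,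
      leaving \<open>V D_j\<close>; its factor \<open>V\<close> together with \<open>c\<close>,
      \<open>H\<close> and \<open>\<Phi>\<close> makes up \<open>D\<close>.\<close>
    have "c * ?br (leval H) (b j) z = (\<Sum>s\<in>?E. leval D (sign_flip s z) *
        (leval (d j) z - leval (d 0) z * monom_at (sign_flip s z) (- j)))"
      using j z unfolding bracket_def sum_distrib_left
      by (intro sum.cong refl) (simp add: b_eval sign_flip_torus D_eval flip)
    \<comment> \<open>The trivial factor with exponent \<open>- 0\<close> gives both sums the form
      of \<open>avg_D\<close>, one with index 0 and one with index \<open>j\<close>.\<close>
    also have "\<dots> = leval (d j) z * (\<Sum>s\<in>?E. leval D (sign_flip s z) * monom_at (sign_flip s z) (- 0)) -
        leval (d 0) z * (\<Sum>s\<in>?E. leval D (sign_flip s z) * monom_at (sign_flip s z) (- j))"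
      by (simp add: sum_distrib_left sum_subtractf[symmetric] algebra_simps)
    also have "\<dots> = leval (d j) z * (?N * leval (d 0) z) - leval (d 0) z * (?N * leval (d j) z)"
      using j by (simp only: avg_D[OF _ z] zero_in_binary_vecs Diff_iff)
    also have "\<dots> = 0" by simp
    finally show ?thesis using c by simp
  qed
  have orth': "?br (b j) (leval H) z = 0" if "j \<in> ?E - {0}" "z \<in> torus" for j z
    using bracket_cnj[of "leval \<Phi>", OF Phi_real that(2), of "leval H" "b j"] orth[OF that] by simp
  have indep: "a j z = 0"
    if a: "\<forall>i\<in>?E. a i \<in> laurent_l1_down" and zero: "\<forall>z\<in>torus. (\<Sum>i\<in>?E. a i z * b i z) = 0"
      and j: "j \<in> ?E" and z: "z \<in> torus" for a j z
  proof -
    have a_flip: "a i (sign_flip s z) = a i z" if "i \<in> ?E" for i s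
      using a that z laurent_l1_down_sign_flip by blast
    \<comment> \<open>The coefficients do not see the sign flip, so one relation yields one for each
      \<open>s\<close> with unchanged coefficients.\<close>
    have zero': "(\<Sum>i\<in>?E. a i z * b i (sign_flip s z)) = 0" for s
      using zero[rule_format, OF sign_flip_torus[OF z], of s] by (simp add: a_flip)
    \<comment> \<open>Taking the bracket of the relation with \<open>H\<close> removes every term
      except that of index 0.\<close>
    have "0 = (\<Sum>s\<in>?E. leval \<Phi> (sign_flip s z) * (\<Sum>i\<in>?E. a i z * b i (sign_flip s z)) * cnj (leval H (sign_flip s z)))"
      by (simp add: zero')
    also have "\<dots> = (\<Sum>i\<in>?E. a i z * ?br (b i) (leval H) z)"
      unfolding bracket_def sum_distrib_left sum_distrib_right
      by (subst sum.swap) (simp only: mult_ac)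
    also have "\<dots> = a 0 z * ?br (b 0) (leval H) z + (\<Sum>i\<in>?E - {0}. a i z * ?br (b i) (leval H) z)"
      by (subst sum.remove[of _ 0]) auto
    also have "\<dots> = a 0 z * leval \<Phi> (vec_square z)"
      using orth' z by (simp add: b0 HH)
    finally have a0: "a 0 z = 0" using Phi_nz[OF vec_square_torus[OF z]] by simp
    show "a j z = 0"
    proof (cases "j = 0")
      case False
      with j have j': "j \<in> ?E - {0}" by simp
      \<comment> \<open>The part of the conjugated relation, divided by \<open>V\<close>, that is
        invariant under sign flips. It plays the role of the constant in
        \<open>sign_flip_independent\<close>.\<close>
      let ?C = "\<Sum>i\<in>?E - {0}. cnj (a i z) * leval (d i) z"
      have eq: "?C = leval (d 0) z * (\<Sum>i\<in>?E - {0}. cnj (a i z) * monom_at (sign_flip s z) (- i))" for s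
      proof -
        let ?w = "sign_flip s z"
        have w: "?w \<in> torus" by (rule sign_flip_torus[OF z])
        have "0 = cnj (\<Sum>i\<in>?E - {0}. a i z * b i ?w)"
          using zero'[of s] a0 by (subst (asm) sum.remove[of _ 0]) auto
        also have "\<dots> = leval V ?w * (\<Sum>i\<in>?E - {0}. cnj (a i z) * (leval (d i) z - leval (d 0) z * monom_at ?w (- i)))"
          unfolding cnj_sum sum_distrib_left
          by (intro sum.cong refl) (simp add: b_eval[OF _ w] flip[OF _ z] mult_ac)
        finally have "(\<Sum>i\<in>?E - {0}. cnj (a i z) * (leval (d i) z - leval (d 0) z * monom_at ?w (- i))) = 0"
          using V_nz[OF w] by simp
        then show ?thesis
          by (simp add: right_diff_distrib sum_subtractf sum_distrib_left mult_ac)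
      qed
      have "cnj (a j z) = 0"
        by (rule sign_flip_independent[OF z eq d0_eval[OF z] j'])
      then show ?thesis by simp
    qed (use a0 in simp)
  qed
  have span: "\<exists>a. (\<forall>i\<in>?E. a i \<in> laurent_l1_down) \<and> (\<forall>z\<in>torus. F z = (\<Sum>i\<in>?E. a i z * b i z))"
    if F: "F \<in> laurent_l1" for F
  proof -
    have iP: "(\<lambda>z. 1 / leval \<Phi> (vec_square z)) \<in> laurent_l1_down"
    proof -
      have "(\<lambda>z. 1 / leval \<Phi> z) \<in> laurent_l1"
        by (rule inverse_positive_l1[OF AB(1) bounds])
      then show ?thesis
        unfolding laurent_l1_down_def by (auto intro!: bexI[of _ "\<lambda>z. 1 / leval \<Phi> z"])
    qed
    \<comment> \<open>The coefficient of the projection of \<open>F\<close> onto \<open>H\<close>,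
      since the denominator is the bracket of \<open>H\<close> with itself.\<close>
    define a0 where "a0 z = ?br F (leval H) z * (1 / leval \<Phi> (vec_square z))" for z
    have a0: "a0 \<in> laurent_l1_down"
      unfolding a0_def by (intro laurent_l1_down_mult bracket_down F leval_l1 iP)
    define R where "R z = F z - a0 z * leval H z" for z
    have R: "R \<in> laurent_l1"
      unfolding R_def by (intro laurent_l1_diff laurent_l1_mult F leval_l1 laurent_l1_down_subset a0)
    have RH: "?br R (leval H) z = 0" if z: "z \<in> torus" for z
    proof -
      have "?br R (leval H) z = ?br F (leval H) z - a0 z * ?br (leval H) (leval H) z"
        unfolding bracket_def R_def laurent_l1_down_sign_flip[OF a0 z] sum_distrib_left sum_subtractf[symmetric]
        by (simp add: algebra_simps)
      then show ?thesis
        using Phi_nz[OF vec_square_torus[OF z]] by (simp add: HH[OF z] a0_def)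
    qed
    define G where "G z = cnj (R z) * W z" for z
    \<comment> \<open>Polyphase components of \<open>G\<close> with respect to
      \<open>z^(-j)\<close>, written as an average over sign flips of a single function so that
      \<open>sum_sign_flip_down\<close> applies.\<close>
    define g where "g j z = (1 / ?N) * (\<Sum>s\<in>?E. (\<lambda>w. G w * leval (lmonom j) w) (sign_flip s z))" for j z
    have g: "g j \<in> laurent_l1_down" for j
      unfolding g_def G_def
      by (intro laurent_l1_down_mult laurent_l1_down_const sum_sign_flip_down laurent_l1_mult laurent_l1_cnj R W leval_l1)
    \<comment> \<open>The requirement is that \<open>G\<close> be the sum of
      \<open>cnj (a_j) * (d_j - d_0 z^(-j))\<close> over nonzero \<open>j\<close>. Comparing
      components at \<open>z^(-j)\<close> forces \<open>g_j = - cnj (a_j) * d_0\<close>, and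
      \<open>U\<close> is the inverse of \<open>d_0\<close>.\<close>
    define a where "a j = (if j = 0 then a0 else (\<lambda>z. (-1) * cnj (g j z * U z)))" for j
    have a: "a j \<in> laurent_l1_down" for j
    proof -
      have "(\<lambda>z. (-1) * cnj (g j z * U z)) \<in> laurent_l1_down"
        by (intro laurent_l1_down_mult laurent_l1_down_const laurent_l1_down_cnj g U)
      then show ?thesis unfolding a_def by (simp only: a0 simp_thms split: if_split)
    qed
    have "F z = (\<Sum>i\<in>?E. a i z * b i z)" if z: "z \<in> torus" for z
    proof -
      have g_sum: "(\<Sum>j\<in>?E. g j z * monom_at z (- j)) = G z"
        using polyphase_expansion[OF z, of G] unfolding g_def leval_lmonom
        by (simp add: sum_divide_distrib[symmetric])
      \<comment> \<open>The component at exponent 0 offers no coefficient to choose: it matches only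
        if this sum is zero. Up to the factor \<open>c / 2^d\<close> the sum is the conjugate of the
        bracket of \<open>R\<close> with \<open>H\<close>.\<close>
      have "(\<Sum>j\<in>?E. g j z * leval (d j) z) =
        (1 / ?N) * (\<Sum>s\<in>?E. G (sign_flip s z) * (\<Sum>j\<in>?E. leval (d j) z * monom_at (sign_flip s z) j))"
        unfolding g_def leval_lmonom sum_distrib_left sum_distrib_right
        by (subst sum.swap) (simp only: mult_ac)
      also have "\<dots> = (1 / ?N) * (\<Sum>s\<in>?E. G (sign_flip s z) * leval D (sign_flip s z))"
        using z by (simp add: D_eval2 sign_flip_torus flip)
      also have "\<dots> = (c / ?N) * cnj (?br R (leval H) z)"
      proof -
        have "G w * leval D w = c * (leval \<Phi> w * leval H w * cnj (R w))" if w: "w \<in> torus" for w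
          using W(2)[OF w] by (simp add: G_def D_eval[OF w] mult.commute)
        then have "(\<Sum>s\<in>?E. G (sign_flip s z) * leval D (sign_flip s z)) = c * ?br (leval H) R z"
          using z by (simp add: bracket_def sum_distrib_left sign_flip_torus)
        then show ?thesis
          using bracket_cnj[of "leval \<Phi>", OF Phi_real z, of R "leval H"] by simp
      qed
      also have "\<dots> = 0" by (simp add: RH[OF z])
      finally have gd: "(\<Sum>j\<in>?E. g j z * leval (d j) z) = 0" .
      have g_sum': "g 0 z + (\<Sum>j\<in>?E - {0}. g j z * monom_at z (- j)) = G z"
        using g_sum by (subst (asm) sum.remove[of _ 0]) auto
      have gd': "g 0 z * leval (d 0) z + (\<Sum>j\<in>?E - {0}. g j z * leval (d j) z) = 0"
        using gd by (subst (asm) sum.remove[of _ 0]) auto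
      have "cnj (\<Sum>i\<in>?E - {0}. a i z * b i z) =
        (\<Sum>i\<in>?E - {0}. leval V z * (U z * leval (d 0) z * (g i z * monom_at z (- i)) - U z * (g i z * leval (d i) z)))"
        unfolding cnj_sum using z by (intro sum.cong refl) (simp add: a_def b_eval algebra_simps)
      also have "\<dots> = leval V z * ((U z * leval (d 0) z) * (\<Sum>i\<in>?E - {0}. g i z * monom_at z (- i)) -
          U z * (\<Sum>i\<in>?E - {0}. g i z * leval (d i) z))"
        by (simp only: sum_distrib_left sum_subtractf right_diff_distrib)
      \<comment> \<open>The vanishing sum turns the contribution of the \<open>d_i\<close> with
        nonzero \<open>i\<close> into the missing component \<open>g_0\<close>.\<close>
      also have "\<dots> = leval V z * ((\<Sum>i\<in>?E - {0}. g i z * monom_at z (- i)) + U z * (g 0 z * leval (d 0) z))"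
        using U(2)[OF z] gd' by (simp add: mult.commute eq_neg_iff_add_eq_0[symmetric] add_eq_0_iff)
      also have "\<dots> = leval V z * G z"
      proof -
        have "U z * (g 0 z * leval (d 0) z) = g 0 z * (leval (d 0) z * U z)"
          by (simp only: mult_ac)
        then have "U z * (g 0 z * leval (d 0) z) = g 0 z"
          by (simp only: U(2)[OF z] mult_1_right)
        then show ?thesis
          unfolding g_sum'[symmetric] by (simp only: add.commute)
      qed
      also have "\<dots> = cnj (R z)" using W(2)[OF z] by (simp add: G_def)
      finally have "(\<Sum>i\<in>?E - {0}. a i z * b i z) = R z"
        unfolding complex_cnj_cancel_iff .
      then have "(\<Sum>i\<in>?E. a i z * b i z) = a0 z * leval H z + R z"
        by (subst sum.remove[of _ 0]) (auto simp: a_def b0)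
      then show ?thesis by (simp add: R_def)
    qed
    with a show ?thesis by blast
  qed
  have "is_basis_over laurent_l1_down laurent_l1 ?E b"
    unfolding is_basis_over_def
    using span indep by (auto simp: b_def[symmetric]) (simp_all add: b_def leval_l1)
  moreover have "\<forall>j\<in>?E - {0}. \<forall>z\<in>torus. ?br (leval H) (leval (H' j)) z = 0"
    using orth by (auto simp: b_def)
  ultimately show ?thesis unfolding b_def[abs_def] by blast
qed

end
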